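(* Assume (A1), and assume (C2) holds for some $0<q<2$. Then $$\sup_{x\in[0,1]^d}|g_n(x)-Eg_n(x)|=O_{a.s.}\!\left[\frac{(\log n)^{1/q}}{(nh_n)^{d/2}}\right].$$
   Context: Fix an integer $d\ge1$. For $x=(x_1,\dots,x_d)\in\mathbb{R}^d$ let $\|x\|=\max_{1\le k\le d}|x_k|$; for $i,j\in\mathbb{Z}^d$ let $|i-j|=\max_{1\le l\le d}|i_l-j_l|$, and $|k|=|k-0|$. Let $(\varepsilon_i)_{i\in\mathbb{Z}^d}$ be a strictly stationary real random field on a probability space $(\Omega,\mathcal F,\mathbb P)$ with $E\varepsilon_0=0$. Strict stationarity means: for all $k\in\mathbb{Z}^d$, $n\ge1$ and $i_1,\dots,i_n\in\mathbb{Z}^d$, the vectors $(\varepsilon_{i_1},\dots,\varepsilon_{i_n})$ and $(\varepsilon_{i_1+k},\dots,\varepsilon_{i_n+k})$ have the same law. Let $g:[0,1]^d\to\mathbb{R}$ and $\Lambda_n=\{1,\dots,n\}^d$, and set $Y_i=g(i/n)+\varepsilon_i$ for $i\in\Lambda_n$. Let $K$ be a probability density on $\mathbb{R}^d$ and $(h_n)_{n\ge1}$ positive numbers with $h_n\to0$ and $nh_n\to\infty$. For $x\in[0,1]^d$ define $$g_n(x)=\frac{\sum_{i\in\Lambda_n}Y_i\,K\big((x-i/n)/h_n\big)}{\sum_{i\in\Lambda_n}K\big((x-i/n)/h_n\big)}.$$ Assumption (A1): $K$ is symmetric and nonnegative, and supported in $[-1,1]^d$. There is $\eta>0$ with $|K(x)-K(y)|\le\eta\|x-y\|$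 for all $x,y\in[-1,1]^d$, and there are constants $c,C>0$ with $c\le K(x)\le C$ for all $x\in[-1,1]^d$. Notation $O_{a.s.}$: for real random variables $Z_n$ and positive numbers $v_n$, $Z_n=O_{a.s.}[v_n]$ means there exists a deterministic $\lambda>0$ with $\limsup_{n\to\infty}|Z_n|/v_n\le\lambda$ almost surely. Dependence notation: $i<_{lex}j$ for distinct $i,j\in\mathbb{Z}^d$ means either $i_1<j_1$, or for some $p\in\{2,\dots,d\}$ one has $i_p<j_p$ and $i_q=j_q$ for $1\le q<p$. Set $V_i^1=\{j\in\mathbb{Z}^d: j<_{lex}i\}$ and, for integers $m\ge2$, $V_i^m=V_i^1\cap\{j:|i-j|\ge m\}$. For $\Gamma\subset\mathbb{Z}^d$ let $\mathcal F_\Gamma=\sigma(\varepsilon_j: j\in\Gamma)$. For $k\in V_0^1$ (so $|k|\ge1$) put $E_{|k|}(\varepsilon_0)=E(\varepsilon_0\mid\mathcal F_{V_0^{|k|}})$. Orlicz notation: for $\beta>0$ let $\psi_\beta(x)=\exp((x+\xi_\beta)^\beta)-\exp(\xi_\beta^\beta)$ for $x\ge0$, where $\xi_\beta=((1-\beta)/\beta)^{1/\beta}$ if $0<\beta<1$ and $\xi_\beta=0$ otherwise. For a real random variable $Z$, $\|Z\|_{\psi_\beta}=\inf\{c>0: E[\psi_\beta(|Z|/c)]\le1\}$, and $L_{\psi_\beta}$ is the space of $Z$ with $\|Z\|_{\psi_\beta}<\infty$. For $0<q<2$ let $\beta(q)=2q/(2-q)$. Condition (C2) (for a given $0<q<2$):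 $\varepsilon_0\in L_{\psi_{\beta(q)}}$ and $\sum_{k\in V_0^1}\big\|\sqrt{|\varepsilon_kE_{|k|}(\varepsilon_0)|}\big\|_{\psi_{\beta(q)}}^2<\infty$. *)

theory Defs
  imports "HOL-Analysis.Analysis" "HOL-Probability.Probability"
begin

text \<open>Dimension d = CARD('d); coordinates indexed by a finite linearly ordered type 'd
  (the order on 'd plays the role of the order 1 < ... < d of coordinates).\<close>

definition maxnorm :: "real^'d::finite \<Rightarrow> real" where
  "maxnorm x = Max (range (\<lambda>k. \<bar>x $ k\<bar>))"

definition idist :: "int^'d::finite \<Rightarrow> int^'d \<Rightarrow> int" where
  "idist i j = Max (range (\<lambda>l. \<bar>i $ l - j $ l\<bar>))"

definition lex_less :: "(int, 'd::{finite,linorder}) vec \<Rightarrow> (int, 'd) vec \<Rightarrow> bool" where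
  "lex_less i j \<longleftrightarrow> (\<exists>p. i $ p < j $ p \<and> (\<forall>q<p. i $ q = j $ q))"

text \<open>V_i^m (for m = 1 the distance condition is automatic).\<close>
definition Vset :: "int \<Rightarrow> (int, 'd::{finite,linorder}) vec \<Rightarrow> (int, 'd) vec set" where
  "Vset m i = {j. lex_less j i \<and> idist i j \<ge> m}"

definition field_sigma :: "'a measure \<Rightarrow> ('i \<Rightarrow> 'a \<Rightarrow> real) \<Rightarrow> 'i set \<Rightarrow> 'a measure" where
  "field_sigma M eps \<Gamma> =
     sigma (space M) {eps j -` A \<inter> space M | j A. j \<in> \<Gamma> \<and> A \<in> sets borel}"

definition xi_beta :: "real \<Rightarrow> real" where
  "xi_beta \<beta> = (if 0 < \<beta> \<and> \<beta> < 1 then ((1 - \<beta>) / \<beta>) powr (1 / \<beta>) else 0)"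

definition psi_beta :: "real \<Rightarrow> real \<Rightarrow> real" where
  "psi_beta \<beta> x = exp ((x + xi_beta \<beta>) powr \<beta>) - exp (xi_beta \<beta> powr \<beta>)"

text \<open>Orlicz norm, valued in [0,\<infinity>] (\<infinity> when no admissible c exists).\<close>
definition orlicz_norm :: "'a measure \<Rightarrow> real \<Rightarrow> ('a \<Rightarrow> real) \<Rightarrow> ennreal" where
  "orlicz_norm M \<beta> Z =
     Inf {ennreal c | c. c > 0 \<and> (\<integral>\<^sup>+ \<omega>. ennreal (psi_beta \<beta> (\<bar>Z \<omega>\<bar> / c)) \<partial>M) \<le> 1}"

definition beta_of :: "real \<Rightarrow> real" where
  "beta_of q = 2 * q / (2 - q)"

definition strictly_stationary ::
  "'a measure \<Rightarrow> (int^'d::finite \<Rightarrow> 'a \<Rightarrow> real) \<Rightarrow> bool" where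
  "strictly_stationary M eps \<longleftrightarrow>
     (\<forall>k (is :: (int, 'd) vec list). 
        distr M (PiM {..<length is} (\<lambda>_. borel)) (\<lambda>\<omega>. \<lambda>m\<in>{..<length is}. eps (is ! m) \<omega>)
      = distr M (PiM {..<length is} (\<lambda>_. borel)) (\<lambda>\<omega>. \<lambda>m\<in>{..<length is}. eps (is ! m + k) \<omega>))"

definition Lam :: "nat \<Rightarrow> (int^'d::finite) set" where
  "Lam n = {i. \<forall>k. 1 \<le> i $ k \<and> i $ k \<le> int n}"

definition scaled :: "nat \<Rightarrow> int^'d::finite \<Rightarrow> real^'d" where
  "scaled n i = (\<chi> k. real_of_int (i $ k) / real n)"

definition unit_cube :: "(real^'d::finite) set" where
  "unit_cube = {x. \<forall>k. 0 \<le> x $ k \<and> x $ k \<le> 1}"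

definition gn :: "(int^'d::finite \<Rightarrow> 'a \<Rightarrow> real) \<Rightarrow> (real^'d \<Rightarrow> real) \<Rightarrow> (real^'d \<Rightarrow> real)
    \<Rightarrow> (nat \<Rightarrow> real) \<Rightarrow> nat \<Rightarrow> real^'d \<Rightarrow> 'a \<Rightarrow> real" where
  "gn eps g K h n x \<omega> =
     (\<Sum>i\<in>Lam n. (g (scaled n i) + eps i \<omega>) * K ((1 / h n) *\<^sub>R (x - scaled n i)))
     / (\<Sum>i\<in>Lam n. K ((1 / h n) *\<^sub>R (x - scaled n i)))"

definition A1 :: "(real^'d::finite \<Rightarrow> real) \<Rightarrow> bool" where
  "A1 K \<longleftrightarrow>
     (\<forall>x. K (- x) = K x) \<and> (\<forall>x. K x \<ge> 0) \<and> (\<forall>x. K x \<noteq> 0 \<longrightarrow> maxnorm x \<le> 1) \<and>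
     (\<exists>\<eta>>0. \<forall>x y. maxnorm x \<le> 1 \<longrightarrow> maxnorm y \<le> 1 \<longrightarrow> \<bar>K x - K y\<bar> \<le> \<eta> * maxnorm (x - y)) \<and>
     (\<exists>c C. 0 < c \<and> 0 < C \<and> (\<forall>x. maxnorm x \<le> 1 \<longrightarrow> c \<le> K x \<and> K x \<le> C))"

definition prob_density :: "(real^'d::finite \<Rightarrow> real) \<Rightarrow> bool" where
  "prob_density K \<longleftrightarrow> (\<forall>x. K x \<ge> 0) \<and> integrable lborel K \<and> integral\<^sup>L lborel K = 1"

definition C2 :: "'a measure \<Rightarrow> ((int, 'd::{finite,linorder}) vec \<Rightarrow> 'a \<Rightarrow> real) \<Rightarrow> real \<Rightarrow> bool" where
  "C2 M eps q \<longleftrightarrow>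
     orlicz_norm M (beta_of q) (eps 0) < \<infinity> \<and>
     (\<integral>\<^sup>+ k. (orlicz_norm M (beta_of q)
         (\<lambda>\<omega>. sqrt \<bar>eps k \<omega> * real_cond_exp M (field_sigma M eps (Vset (idist k 0) 0)) (eps 0) \<omega>\<bar>)) ^ 2
       \<partial>count_space (Vset 1 0)) < \<infinity>"

end

theory Submission
  imports Defs
begin

text \<open>Write the centred estimator as \<open>S = \<Sum> w\<^sub>i \<epsilon>\<^sub>i\<close> with deterministic weights. Expanding
  \<open>S ^ (2 m)\<close> one site at a time in lexicographic order, each new site after a shift being the origin,
  gives a polynomial version of Dedecker's moment inequality,
  \<open>E S ^ (2 m) \<le> (8 m \<Sum> b\<^sub>i) ^ m\<close>, where \<open>b\<^sub>i\<close> collects the norms \<open>\<parallel>\<epsilon>\<^sub>k E\<^sub>|\<^sub>k\<^sub>| \<epsilon>\<^sub>0\<parallel>\<^sub>m\<close>.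
  Under (C2) these norms grow like \<open>m powr (2 / \<beta>)\<close>, and \<open>1 + 2 / \<beta> = 2 / q\<close>, so Markov's inequality with
  \<open>m\<close> of order \<open>log n\<close> bounds the deviations at a single point by \<open>(log n) powr (1 / q)\<close> standard
  deviations outside an event of arbitrarily small polynomial probability. A net of polynomial size and
  the Borel-Cantelli lemma conclude.\<close>

subsection \<open>Moments of sums of two variables\<close>

text \<open>Since \<open>m\<close> is of order \<open>log n\<close>, every additional power of
  \<open>m\<close> in the base of the moment bound would end up as an additional power of
  \<open>log n\<close> in the rate; the factor \<open>8 m\<close> has to be linear. Estimating all
  terms of the expansion in absolute value fails: the terms of first order in the new site
  accumulate as they would in a sum without cancellation. That term alone is kept with its sign, and
  it is the only place where dependence enters, by conditioning the origin on the sites at least as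
  far away as the one just added. Hoelder's inequality suffices for all other terms. The square
  roots in (C2) match this scheme: the \<open>m\<close>-th moment of a product is the
  \<open>2 m\<close>-th moment of its root, so the products may be used only to the power
  \<open>m\<close> while the field itself is used to the power \<open>2 m\<close>. A higher
  polynomial order of the tail at a point costs only a constant factor in the level. The net can
  therefore be finer than any prescribed power of \<open>n\<close>, and between its points the crude
  information \<open>E |\<epsilon>_0| < \<infinity>\<close> is enough.\<close>

lemma weighted_AM_GM_power:
  fixes u v :: real
  assumes "0 \<le> u" "0 \<le> v" "k \<le> n" "0 < n"
  shows "u ^ (n - k) * v ^ k \<le> (real (n - k) * u ^ n + real k * v ^ n) / real n"
proof -
  consider "k = 0" | "k = n" | "0 < k" "k < n" using assms by linarith
  then show ?thesis
  proof cases
    case 3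
    show ?thesis
    proof (cases "u = 0 \<or> v = 0")
      case True
      then show ?thesis using assms 3 by (auto simp: power_0_left)
    next
      case False
      then have uv: "u > 0" "v > 0" using assms by auto
      have e1: "(u ^ n) powr (real (n - k) / real n) = u ^ (n - k)"
        using uv assms by (simp add: powr_powr flip: powr_realpow)
      have e2: "(v ^ n) powr (real k / real n) = v ^ k"
        using uv assms by (simp add: powr_powr flip: powr_realpow)
      have "(u ^ n) powr (real (n - k) / real n) * (v ^ n) powr (real k / real n)
          \<le> real (n - k) / real n * u ^ n + real k / real n * v ^ n"
        using uv assms by (intro Youngs_inequality_0) (auto simp: field_simps of_nat_diff)
      then show ?thesis unfolding e1 e2 by (simp add: add_divide_distrib)
    qed
  qed (use assms in auto)
qed

lemma power_mult_power_le_add: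
  fixes u v :: real
  assumes "0 \<le> u" "0 \<le> v"
  shows "u ^ a * v ^ b \<le> u ^ (a + b) + v ^ (a + b)"
proof (cases "u \<le> v")
  case True
  then have "u ^ a * v ^ b \<le> v ^ a * v ^ b" using assms by (intro mult_right_mono power_mono) auto
  then show ?thesis using assms by (simp add: power_add add_increasing)
next
  case False
  then have "u ^ a * v ^ b \<le> u ^ a * u ^ b" using assms by (intro mult_left_mono power_mono) auto
  then show ?thesis using assms by (simp add: power_add add_increasing2)
qed

text \<open>The first two of the nonnegative binomial terms. It folds a first order term back into
  an \<open>m\<close>-th power, so that bounds keep the shape \<open>(...) ^ m\<close> throughout
  the induction on sites.\<close>

lemma power_add_ge_first_order:
  fixes A B :: real
  assumes "0 \<le> A" "0 \<le> B"
  shows "A ^ m + real m * B * A ^ (m - 1) \<le> (A + B) ^ m"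
proof (induction m)
  case (Suc m)
  show ?case
  proof (cases m)
    case m: (Suc l)
    have "A ^ Suc m + real (Suc m) * B * A ^ m \<le> (A + B) * (A ^ m + real m * B * A ^ (m - 1))"
      using assms by (simp add: m algebra_simps)
    also have "\<dots> \<le> (A + B) * (A + B) ^ m"
      using Suc assms by (intro mult_left_mono) auto
    finally show ?thesis by simp
  qed simp
qed simp

text \<open>The factor is linear in \<open>m\<close> because the first order term is kept apart;
  for \<open>2 m \<beta> \<ge> \<alpha>\<close> that term is negligible, otherwise \<open>exp y \<le> 1 + y + y\<^sup>2\<close> applies
  with \<open>y = 2 m \<beta> / \<alpha>\<close>.\<close>
lemma power_add_le_second_order:
  fixes \<alpha> \<beta> :: real
  assumes "0 \<le> \<alpha>" "0 \<le> \<beta>" "1 \<le> m"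
  shows "(\<alpha> + \<beta>) ^ (2 * m)
    \<le> (\<alpha>\<^sup>2 + 8 * real m * \<beta>\<^sup>2) ^ m + 2 * real m * \<alpha> ^ (2 * m - 1) * \<beta>"
proof (cases "\<alpha> \<le> 2 * real m * \<beta>")
  case True
  have "\<alpha> * \<beta> \<le> 2 * real m * \<beta> * \<beta>" using True assms by (intro mult_right_mono) auto
  then have "2 * \<alpha> * \<beta> \<le> 4 * (real m * \<beta>\<^sup>2)" by (simp add: power2_eq_square mult_ac)
  moreover have "0 \<le> \<beta>\<^sup>2" "\<beta>\<^sup>2 \<le> real m * \<beta>\<^sup>2" using assms by (auto simp: mult_le_cancel_right1)
  ultimately have "(\<alpha> + \<beta>)\<^sup>2 \<le> \<alpha>\<^sup>2 + 8 * real m * \<beta>\<^sup>2"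
    unfolding power2_sum by linarith
  then have "((\<alpha> + \<beta>)\<^sup>2) ^ m \<le> (\<alpha>\<^sup>2 + 8 * real m * \<beta>\<^sup>2) ^ m" by (intro power_mono) auto
  moreover have "0 \<le> 2 * real m * \<alpha> ^ (2 * m - 1) * \<beta>" using assms by simp
  ultimately show ?thesis unfolding power_mult by linarith
next
  case False
  then have pos: "\<alpha> > 0" using assms by (smt (verit) mult_nonneg_nonneg of_nat_0_le_iff)
  define y where "y = 2 * real m * \<beta> / \<alpha>"
  have y: "0 \<le> y" "y \<le> 1" using False pos assms by (auto simp: y_def field_simps)
  have "(1 + \<beta> / \<alpha>) ^ (2 * m) \<le> exp (\<beta> / \<alpha>) ^ (2 * m)"
    using assms pos exp_ge_add_one_self[of "\<beta> / \<alpha>"] by (intro power_mono) auto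
  also have "\<dots> = exp y" by (simp add: y_def flip: exp_of_nat_mult)
  also have "\<dots> \<le> 1 + y + y\<^sup>2" using y by (intro exp_bound) auto
  finally have *: "(1 + \<beta> / \<alpha>) ^ (2 * m) \<le> 1 + y + y\<^sup>2" .
  have p: "\<alpha> ^ (2 * m) = \<alpha>\<^sup>2 * (\<alpha>\<^sup>2) ^ (m - 1)" "\<alpha> ^ (2 * m) = \<alpha> * \<alpha> ^ (2 * m - 1)"
    using assms by (simp_all add: power_mult flip: power_Suc)
  have "(\<alpha> + \<beta>) ^ (2 * m) = \<alpha> ^ (2 * m) * (1 + \<beta> / \<alpha>) ^ (2 * m)"
    using pos by (simp add: distrib_left flip: power_mult_distrib)
  also have "\<dots> \<le> \<alpha> ^ (2 * m) * (1 + y + y\<^sup>2)" using * pos by (intro mult_left_mono) auto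
  also have "\<dots> = \<alpha> ^ (2 * m) + \<alpha> ^ (2 * m) * y + \<alpha> ^ (2 * m) * y\<^sup>2" by (simp add: algebra_simps)
  also have "\<alpha> ^ (2 * m) * y = 2 * real m * \<alpha> ^ (2 * m - 1) * \<beta>"
    unfolding p(2) using pos by (simp add: y_def)
  also have "\<alpha> ^ (2 * m) * y\<^sup>2 = real m * (4 * real m * \<beta>\<^sup>2) * (\<alpha>\<^sup>2) ^ (m - 1)"
    unfolding p(1) using pos by (simp add: y_def power2_eq_square)
  also have "\<alpha> ^ (2 * m) = (\<alpha>\<^sup>2) ^ m" by (simp add: power_mult)
  finally have "(\<alpha> + \<beta>) ^ (2 * m) \<le> (\<alpha>\<^sup>2) ^ m + real m * (4 * real m * \<beta>\<^sup>2) * (\<alpha>\<^sup>2) ^ (m - 1)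
      + 2 * real m * \<alpha> ^ (2 * m - 1) * \<beta>" by simp
  also have "(\<alpha>\<^sup>2) ^ m + real m * (4 * real m * \<beta>\<^sup>2) * (\<alpha>\<^sup>2) ^ (m - 1)
      \<le> (\<alpha>\<^sup>2 + 4 * real m * \<beta>\<^sup>2) ^ m"
    using assms by (intro power_add_ge_first_order) auto
  also have "\<dots> \<le> (\<alpha>\<^sup>2 + 8 * real m * \<beta>\<^sup>2) ^ m" using assms by (intro power_mono) auto
  finally show ?thesis by simp
qed

text \<open>This class is closed under sums, products and powers, so integrability of any polynomial
  in the field and the projected products is settled structurally, without tracking
  exponents.\<close>

definition all_moments :: "'a measure \<Rightarrow> ('a \<Rightarrow> real) \<Rightarrow> bool" where
  "all_moments M f \<longleftrightarrow>
     f \<in> borel_measurable M \<and> (\<forall>n. integrable M (\<lambda>\<omega>. \<bar>f \<omega>\<bar> ^ n))"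

lemma all_momentsD:
  assumes "all_moments M f"
  shows "f \<in> borel_measurable M" "integrable M (\<lambda>\<omega>. \<bar>f \<omega>\<bar> ^ n)"
    "integrable M (\<lambda>\<omega>. f \<omega> ^ n)" "integrable M f"
proof -
  show m[measurable]: "f \<in> borel_measurable M" and i: "\<And>n. integrable M (\<lambda>\<omega>. \<bar>f \<omega>\<bar> ^ n)"
    using assms by (auto simp: all_moments_def)
  show "integrable M (\<lambda>\<omega>. f \<omega> ^ n)" for n
    by (rule Bochner_Integration.integrable_bound[OF i[of n]]) (auto simp: power_abs)
  from this[of 1] show "integrable M f" by simp
qed

lemma all_moments_abs: "all_moments M f \<Longrightarrow> all_moments M (\<lambda>\<omega>. \<bar>f \<omega>\<bar>)"
  by (auto simp: all_moments_def)

lemma (in finite_measure) all_moments_const: "all_moments M (\<lambda>_. c)"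
  by (auto simp: all_moments_def)

lemma all_moments_mult:
  assumes "all_moments M f" "all_moments M g"
  shows "all_moments M (\<lambda>\<omega>. f \<omega> * g \<omega>)"
  unfolding all_moments_def
proof safe
  note [measurable] = all_momentsD(1)[OF assms(1)] all_momentsD(1)[OF assms(2)]
  show "(\<lambda>\<omega>. f \<omega> * g \<omega>) \<in> borel_measurable M" by measurable
  fix n
  have "integrable M (\<lambda>\<omega>. \<bar>f \<omega>\<bar> ^ (n + n) + \<bar>g \<omega>\<bar> ^ (n + n))"
    by (intro Bochner_Integration.integrable_add all_momentsD assms)
  then show "integrable M (\<lambda>\<omega>. \<bar>f \<omega> * g \<omega>\<bar> ^ n)"
  proof (rule Bochner_Integration.integrable_bound)
    have "\<bar>f \<omega> * g \<omega>\<bar> ^ n \<le> \<bar>f \<omega>\<bar> ^ (n + n) + \<bar>g \<omega>\<bar> ^ (n + n)" for \<omega>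
      using power_mult_power_le_add[of "\<bar>f \<omega>\<bar>" "\<bar>g \<omega>\<bar>" n n]
      by (simp add: abs_mult power_mult_distrib)
    then show "AE \<omega> in M. norm (\<bar>f \<omega> * g \<omega>\<bar> ^ n) \<le> norm (\<bar>f \<omega>\<bar> ^ (n + n) + \<bar>g \<omega>\<bar> ^ (n + n))"
      by (intro AE_I2) (smt (verit) real_norm_def zero_le_power abs_ge_zero)
  qed measurable
qed

lemma all_moments_add:
  assumes "all_moments M f" "all_moments M g"
  shows "all_moments M (\<lambda>\<omega>. f \<omega> + g \<omega>)"
  unfolding all_moments_def
proof safe
  note [measurable] = all_momentsD(1)[OF assms(1)] all_momentsD(1)[OF assms(2)]
  show "(\<lambda>\<omega>. f \<omega> + g \<omega>) \<in> borel_measurable M" by measurable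
  fix n
  have "integrable M (\<lambda>\<omega>. 2 ^ n * (\<bar>f \<omega>\<bar> ^ n + \<bar>g \<omega>\<bar> ^ n))"
    by (intro integrable_mult_right Bochner_Integration.integrable_add all_momentsD assms)
  then show "integrable M (\<lambda>\<omega>. \<bar>f \<omega> + g \<omega>\<bar> ^ n)"
  proof (rule Bochner_Integration.integrable_bound)
    have "\<bar>x + y\<bar> ^ n \<le> 2 ^ n * (\<bar>x\<bar> ^ n + \<bar>y\<bar> ^ n)" for x y :: real
    proof -
      have "\<bar>x + y\<bar> ^ n \<le> (2 * max \<bar>x\<bar> \<bar>y\<bar>) ^ n" by (intro power_mono) auto
      also have "\<dots> \<le> 2 ^ n * (\<bar>x\<bar> ^ n + \<bar>y\<bar> ^ n)"
        by (auto simp: power_mult_distrib max_def)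
      finally show ?thesis .
    qed
    then show "AE \<omega> in M. norm (\<bar>f \<omega> + g \<omega>\<bar> ^ n) \<le> norm (2 ^ n * (\<bar>f \<omega>\<bar> ^ n + \<bar>g \<omega>\<bar> ^ n))"
      by (auto intro!: AE_I2)
  qed measurable
qed

lemma (in finite_measure) all_moments_sum:
  "(\<And>j. j \<in> A \<Longrightarrow> all_moments M (f j)) \<Longrightarrow> all_moments M (\<lambda>\<omega>. \<Sum>j\<in>A. f j \<omega>)"
  by (induction A rule: infinite_finite_induct) (auto intro: all_moments_const all_moments_add)

lemma (in finite_measure) all_moments_power:
  "all_moments M f \<Longrightarrow> all_moments M (\<lambda>\<omega>. f \<omega> ^ n)"
  by (induction n) (auto intro: all_moments_const all_moments_mult)

lemmas (in finite_measure) all_moments_intros =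
  all_moments_const all_moments_mult all_moments_add all_moments_sum all_moments_power
  all_moments_abs

text \<open>Weighted AM-GM applied pointwise to the variables divided by bounds of their norms.
  Working with bounds \<open>\<alpha>\<close>, \<open>\<beta>\<close> in place of the norms avoids
  roots.\<close>

lemma (in finite_measure) Holder_power:
  assumes Y: "all_moments M Y" and X: "all_moments M X"
    and n: "k \<le> n" "0 < n" and ab: "0 \<le> \<alpha>" "0 \<le> \<beta>"
    and EY: "(\<integral>\<omega>. \<bar>Y \<omega>\<bar> ^ n \<partial>M) \<le> \<alpha> ^ n" and EX: "(\<integral>\<omega>. \<bar>X \<omega>\<bar> ^ n \<partial>M) \<le> \<beta> ^ n"
  shows "(\<integral>\<omega>. \<bar>Y \<omega>\<bar> ^ (n - k) * \<bar>X \<omega>\<bar> ^ k \<partial>M) \<le> \<alpha> ^ (n - k) * \<beta> ^ k" (is "?I \<le> _")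
proof -
  have pos: "?I \<le> a ^ (n - k) * b ^ k" if a: "\<alpha> \<le> a" "0 < a" and b: "\<beta> \<le> b" "0 < b" for a b
  proof -
    have pt: "\<bar>y\<bar> ^ (n - k) * \<bar>x\<bar> ^ k
        \<le> a ^ (n - k) * b ^ k * ((real (n - k) / a ^ n * \<bar>y\<bar> ^ n + real k / b ^ n * \<bar>x\<bar> ^ n) / real n)"
      for x y :: real
    proof -
      have "\<bar>y\<bar> ^ (n - k) * \<bar>x\<bar> ^ k = a ^ (n - k) * b ^ k * ((\<bar>y\<bar> / a) ^ (n - k) * (\<bar>x\<bar> / b) ^ k)"
        using a b by (simp add: power_divide)
      also have "\<dots> \<le> a ^ (n - k) * b ^ k *
          ((real (n - k) * (\<bar>y\<bar> / a) ^ n + real k * (\<bar>x\<bar> / b) ^ n) / real n)"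
        using a b n by (intro mult_left_mono weighted_AM_GM_power) auto
      finally show ?thesis by (simp add: power_divide)
    qed
    have "?I \<le> (\<integral>\<omega>. a ^ (n - k) * b ^ k *
        ((real (n - k) / a ^ n * \<bar>Y \<omega>\<bar> ^ n + real k / b ^ n * \<bar>X \<omega>\<bar> ^ n) / real n) \<partial>M)"
      using pt by (intro integral_mono all_momentsD(4)[OF all_moments_mult]
          integrable_mult_right integrable_divide Bochner_Integration.integrable_add
          all_moments_intros X Y all_momentsD(2))
    also have "\<dots> = a ^ (n - k) * b ^ k *
        ((real (n - k) / a ^ n * (\<integral>\<omega>. \<bar>Y \<omega>\<bar> ^ n \<partial>M) + real k / b ^ n * (\<integral>\<omega>. \<bar>X \<omega>\<bar> ^ n \<partial>M)) / real n)"
      using all_momentsD(2)[OF X] all_momentsD(2)[OF Y] by simp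
    also have "\<dots> \<le> a ^ (n - k) * b ^ k * ((real (n - k) / a ^ n * a ^ n + real k / b ^ n * b ^ n) / real n)"
      using a b ab
      by (intro mult_left_mono divide_right_mono add_mono order_trans[OF EY] order_trans[OF EX] power_mono) auto
    also have "\<dots> = a ^ (n - k) * b ^ k" using a b n by (simp add: of_nat_diff)
    finally show ?thesis .
  qed
  \<comment> \<open>The bounds may vanish, which rules out dividing by them; the positive bounds
    \<open>\<alpha> + e\<close> and \<open>\<beta> + e\<close> approach them from above.\<close>
  have "((\<lambda>e. (\<alpha> + e) ^ (n - k) * (\<beta> + e) ^ k) \<longlongrightarrow> (\<alpha> + 0) ^ (n - k) * (\<beta> + 0) ^ k) (at_right 0)"
    by (intro tendsto_intros)
  moreover have "eventually (\<lambda>e. ?I \<le> (\<alpha> + e) ^ (n - k) * (\<beta> + e) ^ k) (at_right 0)"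
    using eventually_at_right_less[of "0::real"]
    by eventually_elim (use ab in \<open>auto intro!: pos\<close>)
  ultimately have "?I \<le> (\<alpha> + 0) ^ (n - k) * (\<beta> + 0) ^ k"
    by (rule tendsto_lowerbound) simp
  then show ?thesis by simp
qed

text \<open>Binomial expansion in which the term linear in \<open>X\<close> is left to the caller:
  \<open>c\<close> can be much smaller than the value
  \<open>\<alpha> ^ (2 * m - 1) * \<beta>\<close> that Hoelder would give.\<close>

lemma (in finite_measure) moment_add_le:
  assumes X: "all_moments M X" and T: "all_moments M T"
    and ab: "0 \<le> \<alpha>" "0 \<le> \<beta>" "1 \<le> m"
    and ET: "(\<integral>\<omega>. T \<omega> ^ (2 * m) \<partial>M) \<le> \<alpha> ^ (2 * m)"
    and EX: "(\<integral>\<omega>. X \<omega> ^ (2 * m) \<partial>M) \<le> \<beta> ^ (2 * m)"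
    and cross: "(\<integral>\<omega>. X \<omega> * T \<omega> ^ (2 * m - 1) \<partial>M) \<le> c"
  shows "(\<integral>\<omega>. (X \<omega> + T \<omega>) ^ (2 * m) \<partial>M) \<le> (\<alpha>\<^sup>2 + 8 * real m * \<beta>\<^sup>2) ^ m + 2 * real m * c"
proof -
  let ?J = "\<lambda>k. \<integral>\<omega>. X \<omega> ^ k * T \<omega> ^ (2 * m - k) \<partial>M"
  have int: "integrable M (\<lambda>\<omega>. X \<omega> ^ k * T \<omega> ^ (2 * m - k))" for k
    by (intro all_momentsD(4) all_moments_intros X T)
  have J: "?J k \<le> \<beta> ^ k * \<alpha> ^ (2 * m - k)" if "k \<le> 2 * m" for k
  proof -
    have "?J k \<le> (\<integral>\<omega>. \<bar>T \<omega>\<bar> ^ (2 * m - k) * \<bar>X \<omega>\<bar> ^ k \<partial>M)"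
      using int
    proof (rule integral_mono)
      show "integrable M (\<lambda>\<omega>. \<bar>T \<omega>\<bar> ^ (2 * m - k) * \<bar>X \<omega>\<bar> ^ k)"
        by (intro all_momentsD(4) all_moments_intros X T)
      fix \<omega>
      have "X \<omega> ^ k * T \<omega> ^ (2 * m - k) \<le> \<bar>X \<omega> ^ k * T \<omega> ^ (2 * m - k)\<bar>" by (rule abs_ge_self)
      then show "X \<omega> ^ k * T \<omega> ^ (2 * m - k) \<le> \<bar>T \<omega>\<bar> ^ (2 * m - k) * \<bar>X \<omega>\<bar> ^ k"
        by (simp add: abs_mult power_abs mult.commute)
    qed
    also have "\<dots> \<le> \<alpha> ^ (2 * m - k) * \<beta> ^ k"
      using that ab ET EX by (intro Holder_power T X) (auto simp: power_even_abs)
    finally show ?thesis by (simp add: mult.commute)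
  qed
  have "(\<integral>\<omega>. (X \<omega> + T \<omega>) ^ (2 * m) \<partial>M) = (\<Sum>k\<le>2 * m. real (2 * m choose k) * ?J k)"
    by (simp add: binomial_ring mult.assoc int)
  also have "\<dots> = real (2 * m) * ?J 1 + (\<Sum>k\<in>{..2 * m} - {1}. real (2 * m choose k) * ?J k)"
    using ab by (subst sum.remove[of _ 1]) auto
  also have "\<dots> \<le> real (2 * m) * c + (\<Sum>k\<in>{..2 * m} - {1}. real (2 * m choose k) * (\<beta> ^ k * \<alpha> ^ (2 * m - k)))"
    using cross by (intro add_mono sum_mono mult_left_mono J) auto
  \<comment> \<open>Restoring the missing term completes the power of
    \<open>\<alpha> + \<beta>\<close>; the correction cancels against the first order term in
    \<open>power_add_le_second_order\<close>.\<close>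
  also have "(\<Sum>k\<in>{..2 * m} - {1}. real (2 * m choose k) * (\<beta> ^ k * \<alpha> ^ (2 * m - k)))
      = (\<Sum>k\<le>2 * m. real (2 * m choose k) * (\<beta> ^ k * \<alpha> ^ (2 * m - k))) - 2 * real m * \<alpha> ^ (2 * m - 1) * \<beta>"
    using ab by (subst (2) sum.remove[of _ 1]) auto
  also have "(\<Sum>k\<le>2 * m. real (2 * m choose k) * (\<beta> ^ k * \<alpha> ^ (2 * m - k))) = (\<alpha> + \<beta>) ^ (2 * m)"
    unfolding add.commute[of \<alpha>] by (simp add: binomial_ring mult.assoc)
  finally show ?thesis
    using power_add_le_second_order[OF ab] unfolding of_nat_mult of_nat_numeral by linarith
qed

subsection \<open>A moment inequality for stationary fields\<close>

lemma lex_less_trans: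
  assumes "lex_less i j" "lex_less j k"
  shows "lex_less i k"
proof -
  obtain p where p: "i $ p < j $ p" "\<forall>q<p. i $ q = j $ q" using assms by (auto simp: lex_less_def)
  obtain r where r: "j $ r < k $ r" "\<forall>q<r. j $ q = k $ q" using assms by (auto simp: lex_less_def)
  have "i $ min p r < k $ min p r \<and> (\<forall>q<min p r. i $ q = k $ q)"
    using p r by (cases p r rule: linorder_cases) (auto simp: min_def)
  then show ?thesis unfolding lex_less_def by blast
qed

lemma lex_less_total:
  assumes "i \<noteq> j"
  shows "lex_less i j \<or> lex_less j i"
proof -
  let ?D = "{q. i $ q \<noteq> j $ q}"
  have ne: "?D \<noteq> {}" using assms by (auto simp: vec_eq_iff)
  define p where "p = Min ?D"
  have "p \<in> ?D" unfolding p_def using ne by (intro Min_in) auto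
  then have p: "i $ p \<noteq> j $ p" by simp
  have eq: "\<forall>q<p. i $ q = j $ q"
  proof (intro allI impI, rule ccontr)
    fix q assume q: "q < p" "i $ q \<noteq> j $ q"
    then have "p \<le> q" unfolding p_def by (intro Min_le) auto
    then show False using q by simp
  qed
  then have eq': "\<forall>q<p. j $ q = i $ q" by simp
  from p consider "i $ p < j $ p" | "j $ p < i $ p" by linarith
  then show ?thesis using eq eq' unfolding lex_less_def by cases blast+
qed

lemma exists_lex_greatest:
  assumes "finite G" "G \<noteq> {}"
  shows "\<exists>i\<in>G. \<forall>j\<in>G - {i}. lex_less j i"
  using assms
proof (induction rule: finite_ne_induct)
  case (insert x F)
  then obtain i where i: "i \<in> F" "\<forall>j\<in>F - {i}. lex_less j i" by blast
  show ?case
  proof (cases "lex_less x i")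
    case True
    then show ?thesis using i by blast
  next
    case False
    then have "lex_less i x" using i insert lex_less_total by metis
    then have "lex_less j x" if "j \<in> F" for j using i that lex_less_trans by (metis DiffI singletonD)
    then show ?thesis by blast
  qed
qed simp

lemma idist_commute: "idist i j = idist j i"
  by (simp add: idist_def abs_minus_commute)

lemma idist_zero_ge_one:
  assumes "j \<noteq> 0"
  shows "1 \<le> idist 0 j"
proof -
  obtain l where "j $ l \<noteq> 0" using assms by (auto simp: vec_eq_iff)
  then have "1 \<le> \<bar>0 $ l - j $ l\<bar>" by simp
  also have "\<dots> \<le> idist 0 j" unfolding idist_def by (intro Max_ge) auto
  finally show ?thesis .
qed

lemma lex_less_zero_imp_Vset:
  assumes "lex_less j 0"
  shows "j \<in> Vset 1 0"
proof -
  have "j \<noteq> 0" using assms by (auto simp: lex_less_def)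
  then show ?thesis using assms by (simp add: Vset_def idist_zero_ge_one)
qed

section \<open>Generated sigma-algebras and invariance under shifts\<close>

lemma subalgebra_field_sigma:
  assumes "\<And>j. eps j \<in> borel_measurable M"
  shows "subalgebra M (field_sigma M eps G)"
proof -
  let ?A = "{eps j -` A \<inter> space M | j A. j \<in> G \<and> A \<in> sets borel}"
  have "?A \<subseteq> sets M" using assms by (auto intro: measurable_sets)
  then show ?thesis
    unfolding subalgebra_def field_sigma_def
    by (auto simp: space_measure_of_conv sets_measure_of_conv dest: sets.sets_into_space
        intro: sets.sigma_sets_subset[THEN subsetD])
qed

lemma measurable_field_sigma:
  assumes "j \<in> G"
  shows "eps j \<in> borel_measurable (field_sigma M eps G)"
proof (rule measurableI)
  fix A :: "real set" assume "A \<in> sets borel"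
  then show "eps j -` A \<inter> space (field_sigma M eps G) \<in> sets (field_sigma M eps G)"
    unfolding field_sigma_def
    by (subst sets_measure_of) (use assms in \<open>auto simp: space_measure_of_conv intro!: sigma_sets.Basic\<close>)
qed simp

text \<open>Stationarity speaks of lists of sites. Enumerating \<open>G\<close> without repetition
  turns the weighted sum into one measurable function \<open>\<Phi>\<close> of the vector of values,
  and equality of laws passes to the image.\<close>

lemma stationary_distr_sum:
  fixes eps :: "(int, 'd::finite) vec \<Rightarrow> 'a \<Rightarrow> real"
  assumes st: "strictly_stationary M eps" and [measurable]: "\<And>j. eps j \<in> borel_measurable M"
    and "finite G"
  shows "distr M borel (\<lambda>\<omega>. \<Sum>j\<in>G. w j * eps j \<omega>) = distr M borel (\<lambda>\<omega>. \<Sum>j\<in>G. w j * eps (j + k) \<omega>)"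
proof -
  obtain l where l: "set l = G" "distinct l" using finite_distinct_list[OF \<open>finite G\<close>] by blast
  let ?P = "PiM {..<length l} (\<lambda>_. borel :: real measure)"
  define \<Phi> where "\<Phi> v = (\<Sum>m<length l. w (l ! m) * v m)" for v
  have \<Phi>[measurable]: "\<Phi> \<in> borel_measurable ?P" unfolding \<Phi>_def by measurable
  have red: "(\<Sum>j\<in>G. f j) = (\<Sum>m<length l. f (l ! m))" for f :: "_ \<Rightarrow> real"
    using sum.reindex_bij_betw[OF bij_betw_nth[OF l(2) refl refl], of f] l(1) by simp
  have "distr (distr M ?P (\<lambda>\<omega>. \<lambda>m\<in>{..<length l}. eps (l ! m) \<omega>)) borel \<Phi>
      = distr (distr M ?P (\<lambda>\<omega>. \<lambda>m\<in>{..<length l}. eps (l ! m + k) \<omega>)) borel \<Phi>"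
    using st unfolding strictly_stationary_def by metis
  then have "distr M borel (\<lambda>\<omega>. \<Phi> (\<lambda>m\<in>{..<length l}. eps (l ! m) \<omega>))
      = distr M borel (\<lambda>\<omega>. \<Phi> (\<lambda>m\<in>{..<length l}. eps (l ! m + k) \<omega>))"
    by (subst (asm) (1 2) distr_distr) (auto simp: comp_def)
  then show ?thesis by (simp add: red \<Phi>_def)
qed

lemma stationary_distr:
  fixes eps :: "(int, 'd::finite) vec \<Rightarrow> 'a \<Rightarrow> real"
  assumes "strictly_stationary M eps" "\<And>j. eps j \<in> borel_measurable M"
  shows "distr M borel (eps 0) = distr M borel (eps j)"
  using stationary_distr_sum[OF assms, of "{0}" "\<lambda>_. 1" j] by simp

lemma stationary_integral_sum:
  fixes eps :: "(int, 'd::finite) vec \<Rightarrow> 'a \<Rightarrow> real"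
  assumes "strictly_stationary M eps" and [measurable]: "\<And>j. eps j \<in> borel_measurable M"
    and "finite G" and [measurable]: "f \<in> borel_measurable borel"
  shows "(\<integral>\<omega>. f (\<Sum>j\<in>G. w j * eps j \<omega>) \<partial>M) = (\<integral>\<omega>. f (\<Sum>j\<in>G. w j * eps (j + k) \<omega>) \<partial>M :: real)"
proof -
  have "integral\<^sup>L (distr M borel (\<lambda>\<omega>. \<Sum>j\<in>G. w j * eps j \<omega>)) f
      = integral\<^sup>L (distr M borel (\<lambda>\<omega>. \<Sum>j\<in>G. w j * eps (j + k) \<omega>)) f"
    using stationary_distr_sum[OF assms(1-3)] by simp
  then show ?thesis by (subst (asm) (1 2) integral_distr) auto
qed

section \<open>The moment inequality under plain moment assumptions\<close>

locale moment_field = prob_space M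
  for M :: "'a measure" +
  fixes eps :: "(int, 'd::{finite,linorder}) vec \<Rightarrow> 'a \<Rightarrow> real"
  assumes meas[measurable]: "\<And>j. eps j \<in> borel_measurable M"
    and stat: "strictly_stationary M eps"
    and moments0: "all_moments M (eps 0)"
    and moments_proj: "\<And>j. j \<in> Vset 1 0 \<Longrightarrow> all_moments M
      (\<lambda>\<omega>. eps j \<omega> * real_cond_exp M (field_sigma M eps (Vset (idist j 0) 0)) (eps 0) \<omega>)"
begin

text \<open>The only quantity through which dependence between different sites enters the
  bounds.\<close>

definition Z :: "(int, 'd) vec \<Rightarrow> 'a \<Rightarrow> real" where
  "Z j \<omega> = eps j \<omega> * real_cond_exp M (field_sigma M eps (Vset (idist j 0) 0)) (eps 0) \<omega>"

lemma Z_moments: "j \<in> Vset 1 0 \<Longrightarrow> all_moments M (Z j)"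
  using moments_proj[of j] by (simp add: Z_def[abs_def])

lemma moments: "all_moments M (eps j)"
proof -
  have "integrable M (\<lambda>\<omega>. \<bar>eps j \<omega>\<bar> ^ n)" for n
  proof -
    have "integrable (distr M borel (eps 0)) (\<lambda>x. \<bar>x\<bar> ^ n)"
      using all_momentsD(2)[OF moments0] by (subst integrable_distr_eq) auto
    then have "integrable (distr M borel (eps j)) (\<lambda>x. \<bar>x\<bar> ^ n)"
      using stationary_distr[OF stat meas, of j] by (metis (no_types))
    then show ?thesis by (subst (asm) integrable_distr_eq) auto
  qed
  then show ?thesis by (auto simp: all_moments_def)
qed

text \<open>The site \<open>j\<close> belongs to its own conditioning set
  \<open>Vset (idist j 0) 0\<close>, so \<open>eps j * G\<close> is measurable there and
  \<open>eps 0\<close> may be replaced by its conditional expectation.\<close>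

lemma integral_eps_times_eq:
  assumes j: "j \<in> Vset 1 0" and Gm: "all_moments M G"
    and G[measurable]: "G \<in> borel_measurable (field_sigma M eps (Vset (idist j 0) 0))"
  shows "(\<integral>\<omega>. eps 0 \<omega> * (eps j \<omega> * G \<omega>) \<partial>M) = (\<integral>\<omega>. Z j \<omega> * G \<omega> \<partial>M)"
proof -
  let ?F = "field_sigma M eps (Vset (idist j 0) 0)"
  interpret F: finite_measure_subalgebra M ?F
    by unfold_locales (rule subalgebra_field_sigma[OF meas])
  have "j \<in> Vset (idist j 0) 0" using j by (simp add: Vset_def idist_commute)
  note [measurable] = measurable_field_sigma[OF this, of eps M]
  have "(\<integral>\<omega>. (eps j \<omega> * G \<omega>) * real_cond_exp M ?F (eps 0) \<omega> \<partial>M) = (\<integral>\<omega>. (eps j \<omega> * G \<omega>) * eps 0 \<omega> \<partial>M)"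
    by (intro F.real_cond_exp_intg all_momentsD(4) all_moments_intros moments Gm) auto
  then show ?thesis by (simp add: Z_def mult_ac)
qed

text \<open>The power \<open>T ^ (2 m - 1)\<close> is telescoped by adding the sites in the order of decreasing distance
  to the origin, so that the increment due to \<open>j\<close> is measurable with respect to the
  \<open>\<sigma>\<close>-algebra generated by the sites at distance at least \<open>|j|\<close>.\<close>
lemma cross_moment_le:
  assumes m: "1 \<le> m" and W: "\<And>j. j \<in> A \<Longrightarrow> \<bar>w j\<bar> \<le> W" and \<alpha>: "0 \<le> \<alpha>"
    and z: "\<And>j. j \<in> Vset 1 0 \<Longrightarrow> 0 \<le> z j"
      "\<And>j. j \<in> Vset 1 0 \<Longrightarrow> (\<integral>\<omega>. \<bar>Z j \<omega>\<bar> ^ m \<partial>M) \<le> z j ^ m"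
    and A: "finite A" "A \<subseteq> Vset 1 0"
    and T: "\<And>B. B \<subseteq> A \<Longrightarrow> (\<integral>\<omega>. (\<Sum>j\<in>B. w j * eps j \<omega>) ^ (2 * m) \<partial>M) \<le> \<alpha> ^ (2 * m)"
  shows "\<bar>\<integral>\<omega>. eps 0 \<omega> * (\<Sum>j\<in>A. w j * eps j \<omega>) ^ (2 * m - 1) \<partial>M\<bar>
      \<le> 4 * real m * W * (\<Sum>j\<in>A. z j) * \<alpha> ^ (2 * m - 2)"
proof -
  define n where "n = 2 * m - 1"
  have n: "2 * m - 2 = n - 1" "n - 1 = 2 * (m - 1)" using m by (auto simp: n_def)
  define S where "S B \<omega> = (\<Sum>j\<in>B. w j * eps j \<omega>)" for B \<omega>
  have S: "all_moments M (S B)" for B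
    unfolding S_def[abs_def] by (intro all_moments_intros moments)
  have "\<bar>\<integral>\<omega>. eps 0 \<omega> * S B \<omega> ^ n \<partial>M\<bar> \<le> 4 * real m * W * (\<Sum>j\<in>B. z j) * \<alpha> ^ (n - 1)"
    if "finite B" "B \<subseteq> A" for B
    using that
  \<comment> \<open>The rule inserts an element of greatest rank; negating the distance makes it a
    nearest site.\<close>
  proof (induction B rule: finite_ranking_induct[where f = "\<lambda>j. - idist j 0"])
    case empty
    then show ?case using m by (simp add: S_def n_def power_0_left)
  next
    case (insert j B)
    show ?case
    proof (cases "j \<in> B")
      case True
      then show ?thesis using insert by (simp add: insert_absorb)
    next
      case False
      define F where "F = field_sigma M eps (Vset (idist j 0) 0)"
      have jV: "j \<in> Vset 1 0" and jA: "j \<in> A" and BA: "B \<subseteq> A" using insert A by auto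
      have sub: "insert j B \<subseteq> Vset (idist j 0) 0"
        using insert A(2) by (fastforce simp: Vset_def idist_commute)
      have SF[measurable]: "S C \<in> borel_measurable F" if "C \<subseteq> insert j B" for C
        unfolding S_def[abs_def] F_def
        by (intro borel_measurable_sum borel_measurable_times borel_measurable_const
            measurable_field_sigma) (use that sub in auto)
      \<comment> \<open>The cofactor in \<open>u ^ n - v ^ n = (u - v) * G\<close>, where
        \<open>u\<close> and \<open>v\<close> are the sums with and without \<open>j\<close>, so
        that \<open>u - v = w j * eps j\<close>.\<close>
      define G where "G \<omega> = (\<Sum>i<n. S B \<omega> ^ (n - Suc i) * S (insert j B) \<omega> ^ i)" for \<omega>
      have [measurable]: "G \<in> borel_measurable F"
        unfolding G_def[abs_def] using SF[of B] SF[of "insert j B"] by measurable auto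
      have Gm: "all_moments M G" unfolding G_def[abs_def] by (intro all_moments_intros S)
      have step: "S (insert j B) \<omega> ^ n = S B \<omega> ^ n + w j * eps j \<omega> * G \<omega>" for \<omega>
        using power_diff_sumr2[of "S (insert j B) \<omega>" n "S B \<omega>"] False insert(1)
        by (simp add: G_def S_def algebra_simps)
      have "(\<integral>\<omega>. eps 0 \<omega> * S (insert j B) \<omega> ^ n \<partial>M)
          = (\<integral>\<omega>. eps 0 \<omega> * S B \<omega> ^ n + w j * (eps 0 \<omega> * (eps j \<omega> * G \<omega>)) \<partial>M)"
        by (simp add: step algebra_simps)
      also have "\<dots> = (\<integral>\<omega>. eps 0 \<omega> * S B \<omega> ^ n \<partial>M) + w j * (\<integral>\<omega>. eps 0 \<omega> * (eps j \<omega> * G \<omega>) \<partial>M)"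
        by (subst Bochner_Integration.integral_add)
           (auto intro!: all_momentsD(4) all_moments_intros S Gm moments)
      also have "(\<integral>\<omega>. eps 0 \<omega> * (eps j \<omega> * G \<omega>) \<partial>M) = (\<integral>\<omega>. Z j \<omega> * G \<omega> \<partial>M)"
        using jV Gm \<open>G \<in> borel_measurable F\<close> unfolding F_def by (rule integral_eps_times_eq)
      finally have eq: "(\<integral>\<omega>. eps 0 \<omega> * S (insert j B) \<omega> ^ n \<partial>M)
          = (\<integral>\<omega>. eps 0 \<omega> * S B \<omega> ^ n \<partial>M) + w j * (\<integral>\<omega>. Z j \<omega> * G \<omega> \<partial>M)" .
      \<comment> \<open>As \<open>n - 1 = 2 * (m - 1)\<close> is even, Hoelder of order
        \<open>m\<close> applies to the pair \<open>S C ^ 2\<close>, \<open>Z j\<close>, and moments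
        of \<open>Z j\<close> beyond order \<open>m\<close> do not occur.\<close>
      have hold: "(\<integral>\<omega>. \<bar>Z j \<omega>\<bar> * \<bar>S C \<omega>\<bar> ^ (n - 1) \<partial>M) \<le> z j * \<alpha> ^ (n - 1)" if "C \<subseteq> A" for C
      proof -
        have "(\<integral>\<omega>. \<bar>S C \<omega> ^ 2\<bar> ^ (m - 1) * \<bar>Z j \<omega>\<bar> ^ 1 \<partial>M) \<le> (\<alpha>\<^sup>2) ^ (m - 1) * z j ^ 1"
          using m \<alpha> z[OF jV] T[OF that]
          by (intro Holder_power all_moments_power S Z_moments jV)
             (auto simp: S_def power_mult)
        then show ?thesis unfolding n(2) power_mult by (simp add: mult.commute power_abs)
      qed
      have Gle: "\<bar>G \<omega>\<bar> \<le> real n * (\<bar>S B \<omega>\<bar> ^ (n - 1) + \<bar>S (insert j B) \<omega>\<bar> ^ (n - 1))" for \<omega>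
      proof -
        have "\<bar>G \<omega>\<bar> \<le> (\<Sum>i<n. \<bar>S B \<omega>\<bar> ^ (n - Suc i) * \<bar>S (insert j B) \<omega>\<bar> ^ i)"
          unfolding G_def by (rule order_trans[OF sum_abs]) (simp add: abs_mult power_abs)
        also have "\<dots> \<le> (\<Sum>i<n. \<bar>S B \<omega>\<bar> ^ (n - 1) + \<bar>S (insert j B) \<omega>\<bar> ^ (n - 1))"
        proof (rule sum_mono)
          fix i assume "i \<in> {..<n}"
          then have "n - Suc i + i = n - 1" by auto
          then show "\<bar>S B \<omega>\<bar> ^ (n - Suc i) * \<bar>S (insert j B) \<omega>\<bar> ^ i
              \<le> \<bar>S B \<omega>\<bar> ^ (n - 1) + \<bar>S (insert j B) \<omega>\<bar> ^ (n - 1)"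
            using power_mult_power_le_add[of "\<bar>S B \<omega>\<bar>" "\<bar>S (insert j B) \<omega>\<bar>" "n - Suc i" i] by simp
        qed
        finally show ?thesis by simp
      qed
      have "\<bar>\<integral>\<omega>. Z j \<omega> * G \<omega> \<partial>M\<bar> \<le> (\<integral>\<omega>. \<bar>Z j \<omega> * G \<omega>\<bar> \<partial>M)" by (rule integral_abs_bound)
      also have "\<dots> \<le> (\<integral>\<omega>. real n * (\<bar>Z j \<omega>\<bar> * \<bar>S B \<omega>\<bar> ^ (n - 1) + \<bar>Z j \<omega>\<bar> * \<bar>S (insert j B) \<omega>\<bar> ^ (n - 1)) \<partial>M)"
      proof (intro integral_mono all_momentsD(4) all_moments_intros S Z_moments jV Gm)
        fix \<omega>
        show "\<bar>Z j \<omega> * G \<omega>\<bar> \<le> real n * (\<bar>Z j \<omega>\<bar> * \<bar>S B \<omega>\<bar> ^ (n - 1) + \<bar>Z j \<omega>\<bar> * \<bar>S (insert j B) \<omega>\<bar> ^ (n - 1))"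
          using mult_left_mono[OF Gle[of \<omega>], of "\<bar>Z j \<omega>\<bar>"] by (simp add: abs_mult algebra_simps)
      qed
      also have "\<dots> = real n * ((\<integral>\<omega>. \<bar>Z j \<omega>\<bar> * \<bar>S B \<omega>\<bar> ^ (n - 1) \<partial>M)
          + (\<integral>\<omega>. \<bar>Z j \<omega>\<bar> * \<bar>S (insert j B) \<omega>\<bar> ^ (n - 1) \<partial>M))"
        by (subst integral_mult_right_zero, subst Bochner_Integration.integral_add)
           (auto intro!: all_momentsD(4) all_moments_intros S Z_moments jV)
      also have "\<dots> \<le> real n * (z j * \<alpha> ^ (n - 1) + z j * \<alpha> ^ (n - 1))"
        using jA BA by (intro mult_left_mono add_mono hold) auto
      \<comment> \<open>\<open>G\<close> has \<open>n < 2 * m\<close> summands, each bounded by two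
        pure powers; hence the factor \<open>4 * m\<close>.\<close>
      also have "\<dots> \<le> 4 * real m * (z j * \<alpha> ^ (n - 1))"
      proof -
        have "real n \<le> 2 * real m" unfolding n_def by linarith
        then have "real n * (2 * (z j * \<alpha> ^ (n - 1))) \<le> 2 * real m * (2 * (z j * \<alpha> ^ (n - 1)))"
          using z(1)[OF jV] \<alpha> by (intro mult_right_mono) auto
        then show ?thesis by simp
      qed
      finally have "\<bar>w j * (\<integral>\<omega>. Z j \<omega> * G \<omega> \<partial>M)\<bar> \<le> W * (4 * real m * (z j * \<alpha> ^ (n - 1)))"
        using W[OF jA] unfolding abs_mult by (intro mult_mono) auto
      then have "\<bar>\<integral>\<omega>. eps 0 \<omega> * S (insert j B) \<omega> ^ n \<partial>M\<bar>
          \<le> 4 * real m * W * (\<Sum>j\<in>B. z j) * \<alpha> ^ (n - 1) + W * (4 * real m * (z j * \<alpha> ^ (n - 1)))"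
        unfolding eq using insert(3)[OF BA] by linarith
      also have "\<dots> = 4 * real m * W * (\<Sum>j\<in>insert j B. z j) * \<alpha> ^ (n - 1)"
        using False insert(1) by (simp add: algebra_simps)
      finally show ?thesis .
    qed
  qed
  from this[OF A(1)] show ?thesis by (simp add: S_def n_def n(1)[unfolded n_def])
qed

text \<open>The bound sees \<open>\<Gamma>\<close> and \<open>w\<close> only through
  \<open>card \<Gamma>\<close> and \<open>W\<close>, so it survives both the shift and the passage
  to subsets. A further site raises the base of the \<open>m\<close>-th power by at most
  \<open>8 m W^2 D\<close>; \<open>D\<close> dominates all finite parts of the past because the
  shifted index set changes from step to step.\<close>

lemma moment_weighted_sum_le:
  assumes m: "1 \<le> m" and "finite \<Gamma>" "\<And>j. j \<in> \<Gamma> \<Longrightarrow> \<bar>w j\<bar> \<le> W" and "0 \<le> W"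
    and b: "0 \<le> b" "(\<integral>\<omega>. eps 0 \<omega> ^ (2 * m) \<partial>M) \<le> b ^ m"
    and z: "\<And>j. j \<in> Vset 1 0 \<Longrightarrow> 0 \<le> z j"
      "\<And>j. j \<in> Vset 1 0 \<Longrightarrow> (\<integral>\<omega>. \<bar>Z j \<omega>\<bar> ^ m \<partial>M) \<le> z j ^ m"
    and D: "\<And>A. finite A \<Longrightarrow> A \<subseteq> Vset 1 0 \<Longrightarrow> b + (\<Sum>j\<in>A. z j) \<le> D"
  shows "(\<integral>\<omega>. (\<Sum>j\<in>\<Gamma>. w j * eps j \<omega>) ^ (2 * m) \<partial>M) \<le> (8 * real m * W\<^sup>2 * (real (card \<Gamma>) * D)) ^ m"
  using assms(2,3)
proof (induction "card \<Gamma>" arbitrary: \<Gamma> w rule: less_induct)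
  case less
  have D0: "0 \<le> D" using D[of "{}"] b by simp
  show ?case
  proof (cases "\<Gamma> = {}")
    case True
    then show ?thesis using m by (simp add: power_0_left)
  next
    case False
    then obtain i where i: "i \<in> \<Gamma>" "\<forall>j\<in>\<Gamma> - {i}. lex_less j i"
      using exists_lex_greatest less.prems(1) by blast
    define v where "v j = w (j + i)" for j
    define A where "A = (\<lambda>j. j - i) ` (\<Gamma> - {i})"
    have finA: "finite A" using less.prems(1) by (simp add: A_def)
    have "card A = card (\<Gamma> - {i})" unfolding A_def by (intro card_image) (auto simp: inj_on_def)
    then have cardA: "card \<Gamma> = Suc (card A)"
      using card.remove[OF less.prems(1) i(1)] by simp
    have AV: "A \<subseteq> Vset 1 0"
    proof
      fix k assume "k \<in> A"
      then obtain j where "k = j - i" "lex_less j i" using i(2) by (auto simp: A_def)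
      then show "k \<in> Vset 1 0" by (intro lex_less_zero_imp_Vset) (auto simp: lex_less_def)
    qed
    have v: "\<bar>v j\<bar> \<le> W" if "j \<in> insert 0 A" for j
      using that less.prems(2) i(1) by (auto simp: v_def A_def)
    have "(\<integral>\<omega>. (\<Sum>j\<in>\<Gamma>. w j * eps j \<omega>) ^ (2 * m) \<partial>M) = (\<integral>\<omega>. (\<Sum>j\<in>\<Gamma>. w j * eps (j + - i) \<omega>) ^ (2 * m) \<partial>M)"
      by (rule stationary_integral_sum[OF stat meas less.prems(1)]) auto
    also have "(\<lambda>\<omega>. \<Sum>j\<in>\<Gamma>. w j * eps (j + - i) \<omega>) = (\<lambda>\<omega>. v 0 * eps 0 \<omega> + (\<Sum>j\<in>A. v j * eps j \<omega>))"
      using less.prems(1) i(1)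
      by (intro ext, subst sum.remove[of _ i]) (auto simp: A_def v_def sum.reindex inj_on_def)
    finally have shift: "(\<integral>\<omega>. (\<Sum>j\<in>\<Gamma>. w j * eps j \<omega>) ^ (2 * m) \<partial>M)
        = (\<integral>\<omega>. (v 0 * eps 0 \<omega> + (\<Sum>j\<in>A. v j * eps j \<omega>)) ^ (2 * m) \<partial>M)" .
    define a where "a = 8 * real m * W\<^sup>2 * (real (card A) * D)"
    define s where "s = (\<Sum>j\<in>A. z j)"
    have a0: "0 \<le> a" using D0 by (simp add: a_def)
    have s0: "0 \<le> s" using z(1) AV by (auto simp: s_def intro: sum_nonneg)
    \<comment> \<open>All subsets are needed, since the telescoping in
      \<open>cross_moment_le\<close> runs through partial sums; the bound is increasing in the
      cardinality, so one \<open>a\<close> serves them all.\<close>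
    have IH: "(\<integral>\<omega>. (\<Sum>j\<in>B. v j * eps j \<omega>) ^ (2 * m) \<partial>M) \<le> sqrt a ^ (2 * m)" if "B \<subseteq> A" for B
    proof -
      have c: "card B \<le> card A" using that finA by (rule card_mono[rotated])
      have "(\<integral>\<omega>. (\<Sum>j\<in>B. v j * eps j \<omega>) ^ (2 * m) \<partial>M) \<le> (8 * real m * W\<^sup>2 * (real (card B) * D)) ^ m"
        using c cardA finite_subset[OF that finA] v that by (intro less.hyps) auto
      also have "\<dots> \<le> a ^ m"
        unfolding a_def using c D0 by (intro power_mono mult_left_mono mult_right_mono) auto
      finally show ?thesis using a0 by (simp add: power_mult)
    qed
    have X: "(\<integral>\<omega>. (v 0 * eps 0 \<omega>) ^ (2 * m) \<partial>M) \<le> (W * sqrt b) ^ (2 * m)"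
    proof -
      have "(\<integral>\<omega>. (v 0 * eps 0 \<omega>) ^ (2 * m) \<partial>M) = \<bar>v 0\<bar> ^ (2 * m) * (\<integral>\<omega>. eps 0 \<omega> ^ (2 * m) \<partial>M)"
        by (simp add: power_mult_distrib power_even_abs)
      also have "\<dots> \<le> W ^ (2 * m) * b ^ m"
        using v[of 0] b \<open>0 \<le> W\<close> by (intro mult_mono power_mono) auto
      finally show ?thesis using b by (simp add: power_mult_distrib power_mult)
    qed
    have cross: "(\<integral>\<omega>. v 0 * eps 0 \<omega> * (\<Sum>j\<in>A. v j * eps j \<omega>) ^ (2 * m - 1) \<partial>M)
        \<le> W * (4 * real m * W * s * a ^ (m - 1))"
    proof -
      let ?I = "\<integral>\<omega>. eps 0 \<omega> * (\<Sum>j\<in>A. v j * eps j \<omega>) ^ (2 * m - 1) \<partial>M"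
      have "\<bar>?I\<bar> \<le> 4 * real m * W * s * sqrt a ^ (2 * m - 2)"
        unfolding s_def using m v a0 z finA AV IH by (intro cross_moment_le) auto
      also have "sqrt a ^ (2 * m - 2) = a ^ (m - 1)"
      proof -
        have "2 * m - 2 = 2 * (m - 1)" by simp
        then show ?thesis using a0 by (simp only: power_mult real_sqrt_pow2)
      qed
      finally have I: "\<bar>?I\<bar> \<le> 4 * real m * W * s * a ^ (m - 1)" .
      have "(\<integral>\<omega>. v 0 * eps 0 \<omega> * (\<Sum>j\<in>A. v j * eps j \<omega>) ^ (2 * m - 1) \<partial>M) = v 0 * ?I"
        by (simp add: mult.assoc)
      also have "\<dots> \<le> \<bar>v 0\<bar> * \<bar>?I\<bar>" using abs_ge_self[of "v 0 * ?I"] unfolding abs_mult .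
      also have "\<dots> \<le> W * (4 * real m * W * s * a ^ (m - 1))"
        using v[of 0] I \<open>0 \<le> W\<close> by (intro mult_mono) auto
      finally show ?thesis .
    qed
    define a' where "a' = a + 8 * real m * (W * sqrt b)\<^sup>2"
    have a': "a \<le> a'" "0 \<le> a'" using a0 by (auto simp: a'_def)
    have "(\<integral>\<omega>. (v 0 * eps 0 \<omega> + (\<Sum>j\<in>A. v j * eps j \<omega>)) ^ (2 * m) \<partial>M)
        \<le> ((sqrt a)\<^sup>2 + 8 * real m * (W * sqrt b)\<^sup>2) ^ m + 2 * real m * (W * (4 * real m * W * s * a ^ (m - 1)))"
      by (rule moment_add_le[OF _ _ _ _ m IH[OF order_refl] X cross])
         (use a0 b \<open>0 \<le> W\<close> in \<open>auto intro!: all_moments_intros moments\<close>)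
    \<comment> \<open>The cross term now looks like the first order term of an \<open>m\<close>-th
      power and can be absorbed into the base. The new site then contributes \<open>b\<close> for
      itself and \<open>s\<close> for its interaction with the past, together at most
      \<open>D\<close>.\<close>
    also have "\<dots> = a' ^ m + real m * (8 * real m * W\<^sup>2 * s) * a ^ (m - 1)"
      using a0 by (simp add: a'_def power2_eq_square)
    also have "\<dots> \<le> a' ^ m + real m * (8 * real m * W\<^sup>2 * s) * a' ^ (m - 1)"
      using a' a0 s0 by (intro add_left_mono mult_left_mono power_mono) auto
    also have "\<dots> \<le> (a' + 8 * real m * W\<^sup>2 * s) ^ m"
      using a' s0 by (intro power_add_ge_first_order) auto
    also have "a' + 8 * real m * W\<^sup>2 * s = 8 * real m * W\<^sup>2 * (real (card A) * D + (b + s))"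
      using b by (simp add: a'_def a_def power_mult_distrib algebra_simps)
    also have "(8 * real m * W\<^sup>2 * (real (card A) * D + (b + s))) ^ m
        \<le> (8 * real m * W\<^sup>2 * (real (card \<Gamma>) * D)) ^ m"
      using D[OF finA AV] b s0 D0
      by (intro power_mono mult_left_mono) (auto simp: s_def cardA algebra_simps)
    finally show ?thesis unfolding shift .
  qed
qed

end

subsection \<open>Moment growth from Orlicz norms\<close>

lemma powr_self_le_exp:
  fixes s t :: real
  assumes "0 < s" "0 < t"
  shows "t powr s \<le> s powr s * exp t"
proof -
  have "ln (t / s) \<le> t / s" using assms ln_le_minus_one[of "t / s"] by simp
  then have "s * ln t \<le> s * ln s + t" using assms by (simp add: ln_div field_simps)
  then have "exp (s * ln t) \<le> exp (s * ln s + t)" by simp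
  then show ?thesis using assms by (simp add: powr_def exp_add)
qed

lemma xi_beta_nonneg: "0 \<le> xi_beta \<beta>"
  by (simp add: xi_beta_def)

lemma psi_beta_nonneg: "0 < \<beta> \<Longrightarrow> 0 \<le> x \<Longrightarrow> 0 \<le> psi_beta \<beta> x"
  using powr_mono2[of \<beta> "xi_beta \<beta>" "x + xi_beta \<beta>"] xi_beta_nonneg[of \<beta>]
  by (simp add: psi_beta_def)

text \<open>Write \<open>x ^ p\<close> as a power of \<open>x powr \<beta>\<close> with exponent
  \<open>p / \<beta>\<close> and compare with the exponential. The shift
  \<open>xi_beta \<beta>\<close> only enlarges the exponent; the constant subtracted in
  \<open>psi_beta\<close> is added back on the right.\<close>

lemma power_le_psi_beta:
  assumes "0 < \<beta>" "0 \<le> x" "1 \<le> p"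
  shows "x ^ p \<le> ((real p / \<beta>) powr (1 / \<beta>)) ^ p * (psi_beta \<beta> x + exp (xi_beta \<beta> powr \<beta>))"
proof (cases "x = 0")
  case True
  then show ?thesis using assms psi_beta_nonneg[of \<beta> x] by (simp add: power_0_left)
next
  case False
  then have x: "0 < x" using assms by simp
  have "x ^ p = (x powr \<beta>) powr (real p / \<beta>)"
    using x assms by (simp add: powr_powr powr_realpow)
  also have "\<dots> \<le> (real p / \<beta>) powr (real p / \<beta>) * exp (x powr \<beta>)"
    using x assms by (intro powr_self_le_exp) auto
  also have "\<dots> \<le> (real p / \<beta>) powr (real p / \<beta>) * exp ((x + xi_beta \<beta>) powr \<beta>)"
    using x assms xi_beta_nonneg[of \<beta>] by (intro mult_left_mono) (auto intro!: powr_mono2)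
  also have "(real p / \<beta>) powr (real p / \<beta>) = ((real p / \<beta>) powr (1 / \<beta>)) ^ p"
    using assms by (simp add: powr_powr flip: powr_realpow)
  finally show ?thesis by (simp add: psi_beta_def)
qed

text \<open>The factor, the same for every \<open>p\<close>, by which
  \<open>p powr (1 / \<beta>)\<close> times the Orlicz norm bounds the norm in
  \<open>L^p\<close>.\<close>

definition orlicz_const :: "real \<Rightarrow> real" where
  "orlicz_const \<beta> = (1 / \<beta>) powr (1 / \<beta>) * (1 + exp (xi_beta \<beta> powr \<beta>))"

lemma orlicz_const_pos: "0 < \<beta> \<Longrightarrow> 0 < orlicz_const \<beta>"
  by (simp add: orlicz_const_def add_pos_pos)

lemma (in prob_space) nn_moment_le_of_psi_beta:
  assumes \<beta>: "0 < \<beta>" and c: "0 < c" and p: "1 \<le> p"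
    and [measurable]: "X \<in> borel_measurable M"
    and psi: "(\<integral>\<^sup>+\<omega>. ennreal (psi_beta \<beta> (\<bar>X \<omega>\<bar> / c)) \<partial>M) \<le> 1"
  shows "(\<integral>\<^sup>+\<omega>. ennreal (\<bar>X \<omega>\<bar> ^ p) \<partial>M) \<le> ennreal ((orlicz_const \<beta> * real p powr (1 / \<beta>) * c) ^ p)"
proof -
  define e where "e = exp (xi_beta \<beta> powr \<beta>)"
  define r where "r = (real p / \<beta>) powr (1 / \<beta>)"
  have pos: "0 < e" "0 < r" using \<beta> p by (auto simp: e_def r_def)
  have [measurable]: "(\<lambda>\<omega>. psi_beta \<beta> (\<bar>X \<omega>\<bar> / c)) \<in> borel_measurable M"
    unfolding psi_beta_def by measurable
  have "(\<integral>\<^sup>+\<omega>. ennreal (\<bar>X \<omega>\<bar> ^ p) \<partial>M)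
      \<le> (\<integral>\<^sup>+\<omega>. ennreal ((c * r) ^ p) * (ennreal (psi_beta \<beta> (\<bar>X \<omega>\<bar> / c)) + ennreal e) \<partial>M)"
  proof (rule nn_integral_mono)
    fix \<omega>
    have "(\<bar>X \<omega>\<bar> / c) ^ p \<le> r ^ p * (psi_beta \<beta> (\<bar>X \<omega>\<bar> / c) + e)"
      unfolding r_def e_def using \<beta> c p by (intro power_le_psi_beta) auto
    then have "\<bar>X \<omega>\<bar> ^ p \<le> (c * r) ^ p * (psi_beta \<beta> (\<bar>X \<omega>\<bar> / c) + e)"
      using c by (simp add: power_divide power_mult_distrib divide_le_eq mult_ac)
    then have "ennreal (\<bar>X \<omega>\<bar> ^ p) \<le> ennreal ((c * r) ^ p * (psi_beta \<beta> (\<bar>X \<omega>\<bar> / c) + e))"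
      by (rule ennreal_leI)
    also have "\<dots> = ennreal ((c * r) ^ p) * (ennreal (psi_beta \<beta> (\<bar>X \<omega>\<bar> / c)) + ennreal e)"
      using c pos psi_beta_nonneg[OF \<beta>, of "\<bar>X \<omega>\<bar> / c"] by (simp add: ennreal_mult ennreal_plus)
    finally show "ennreal (\<bar>X \<omega>\<bar> ^ p) \<le> ennreal ((c * r) ^ p) * (ennreal (psi_beta \<beta> (\<bar>X \<omega>\<bar> / c)) + ennreal e)" .
  qed
  also have "\<dots> = ennreal ((c * r) ^ p) * ((\<integral>\<^sup>+\<omega>. ennreal (psi_beta \<beta> (\<bar>X \<omega>\<bar> / c)) \<partial>M) + ennreal e)"
    by (simp add: nn_integral_cmult nn_integral_add emeasure_space_1)
  also have "\<dots> \<le> ennreal ((c * r) ^ p) * (1 + ennreal e)"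
    using psi by (intro mult_left_mono add_right_mono) auto
  also have "\<dots> = ennreal ((c * r) ^ p * (1 + e))"
    using pos c by (simp add: ennreal_mult ennreal_plus)
  \<comment> \<open>A constant at least 1 in front of a \<open>p\<close>-th power may be moved
    inside; the resulting factor of the norm does not depend on \<open>p\<close>.\<close>
  also have "\<dots> \<le> ennreal ((c * r * (1 + e)) ^ p)"
  proof (rule ennreal_leI)
    have "1 + e \<le> (1 + e) ^ p" using pos p by (intro self_le_power) auto
    then show "(c * r) ^ p * (1 + e) \<le> (c * r * (1 + e)) ^ p"
      using pos c by (simp add: power_mult_distrib[of "c * r"])
  qed
  also have "c * r * (1 + e) = orlicz_const \<beta> * real p powr (1 / \<beta>) * c"
    using \<beta> by (simp add: r_def e_def orlicz_const_def powr_divide)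
  finally show ?thesis .
qed

text \<open>The infimum defining the norm may be 0 and need not be attained, so the bound is shown
  for every \<open>a\<close> above it and then passed to the limit from the right.\<close>

lemma (in prob_space) moments_of_finite_orlicz_norm:
  assumes \<beta>: "0 < \<beta>" and X[measurable]: "X \<in> borel_measurable M"
    and fin: "orlicz_norm M \<beta> X < \<infinity>"
  shows "all_moments M X"
    and "1 \<le> p \<Longrightarrow> (\<integral>\<omega>. \<bar>X \<omega>\<bar> ^ p \<partial>M)
      \<le> (orlicz_const \<beta> * real p powr (1 / \<beta>) * enn2real (orlicz_norm M \<beta> X)) ^ p"
proof -
  define N where "N = enn2real (orlicz_norm M \<beta> X)"
  have N: "orlicz_norm M \<beta> X = ennreal N" "0 \<le> N" using fin by (auto simp: N_def less_top)
  have nn: "(\<integral>\<^sup>+\<omega>. ennreal (\<bar>X \<omega>\<bar> ^ p) \<partial>M) \<le> ennreal ((orlicz_const \<beta> * real p powr (1 / \<beta>) * a) ^ p)"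
    if "N < a" "1 \<le> p" for a p
  proof -
    have "orlicz_norm M \<beta> X < ennreal a" using that N by (simp add: ennreal_less_iff)
    then obtain c where c: "0 < c" "ennreal c < ennreal a"
      "(\<integral>\<^sup>+\<omega>. ennreal (psi_beta \<beta> (\<bar>X \<omega>\<bar> / c)) \<partial>M) \<le> 1"
      unfolding orlicz_norm_def Inf_less_iff by blast
    have ca: "c \<le> a" using c by (metis ennreal_less_iff less_imp_le)
    have "(\<integral>\<^sup>+\<omega>. ennreal (\<bar>X \<omega>\<bar> ^ p) \<partial>M) \<le> ennreal ((orlicz_const \<beta> * real p powr (1 / \<beta>) * c) ^ p)"
      using \<beta> c that by (intro nn_moment_le_of_psi_beta) auto
    also have "\<dots> \<le> ennreal ((orlicz_const \<beta> * real p powr (1 / \<beta>) * a) ^ p)"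
      using ca c orlicz_const_pos[OF \<beta>] by (intro ennreal_leI power_mono mult_left_mono) auto
    finally show ?thesis .
  qed
  have int: "integrable M (\<lambda>\<omega>. \<bar>X \<omega>\<bar> ^ p)" for p
  proof (cases "p = 0")
    case False
    then have "(\<integral>\<^sup>+\<omega>. ennreal (\<bar>X \<omega>\<bar> ^ p) \<partial>M) < \<infinity>"
      using nn[of "N + 1" p] by (auto intro: le_less_trans)
    then show ?thesis by (intro integrableI_bounded) auto
  qed simp
  then show "all_moments M X" by (auto simp: all_moments_def)
  assume p: "1 \<le> p"
  let ?f = "\<lambda>a. (orlicz_const \<beta> * real p powr (1 / \<beta>) * a) ^ p"
  have "(?f \<longlongrightarrow> ?f N) (at_right N)" by (intro tendsto_intros)
  moreover have "eventually (\<lambda>a. (\<integral>\<omega>. \<bar>X \<omega>\<bar> ^ p \<partial>M) \<le> ?f a) (at_right N)"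
    using eventually_at_right_less[of N]
  proof eventually_elim
    case (elim a)
    have "0 \<le> ?f a" using elim N orlicz_const_pos[OF \<beta>] by simp
    then show ?case
      using nn[OF elim p] int[of p] by (subst (asm) nn_integral_eq_integral) (auto simp: ennreal_le_iff)
  qed
  ultimately have "(\<integral>\<omega>. \<bar>X \<omega>\<bar> ^ p \<partial>M) \<le> ?f N" by (rule tendsto_lowerbound) simp
  then show "(\<integral>\<omega>. \<bar>X \<omega>\<bar> ^ p \<partial>M) \<le> (orlicz_const \<beta> * real p powr (1 / \<beta>) * enn2real (orlicz_norm M \<beta> X)) ^ p"
    by (simp add: N_def)
qed

lemma sum_enn2real_le_nn_integral_count_space:
  assumes "finite A" "A \<subseteq> V" and fin: "(\<integral>\<^sup>+k. f k \<partial>count_space V) < \<infinity>"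
  shows "(\<Sum>k\<in>A. enn2real (f k)) \<le> enn2real (\<integral>\<^sup>+k. f k \<partial>count_space V)"
    and "k \<in> V \<Longrightarrow> f k < \<infinity>"
proof -
  have le: "(\<Sum>k\<in>B. f k) \<le> (\<integral>\<^sup>+k. f k \<partial>count_space V)" if "finite B" "B \<subseteq> V" for B
  proof -
    have "(\<Sum>k\<in>B. f k) = (\<Sum>k\<in>B. f k * indicator B k)" by (intro sum.cong) auto
    also have "\<dots> = (\<integral>\<^sup>+k. f k * indicator B k \<partial>count_space V)"
      using that by (subst nn_integral_count_space'[of B]) auto
    also have "\<dots> \<le> (\<integral>\<^sup>+k. f k \<partial>count_space V)"
      by (intro nn_integral_mono) (auto simp: indicator_def)
    finally show ?thesis .
  qed
  show f: "f k < \<infinity>" if "k \<in> V" for k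
    using le[of "{k}"] that fin by (auto intro: le_less_trans)
  have "(\<Sum>k\<in>A. enn2real (f k)) = enn2real (\<Sum>k\<in>A. f k)"
    using f assms(2) by (subst enn2real_sum) auto
  also have "\<dots> \<le> enn2real (\<integral>\<^sup>+k. f k \<partial>count_space V)"
    using le[OF assms(1,2)] fin by (intro enn2real_mono) auto
  finally show "(\<Sum>k\<in>A. enn2real (f k)) \<le> enn2real (\<integral>\<^sup>+k. f k \<partial>count_space V)" .
qed

text \<open>One \<open>L\<close> serves all orders, index sets and weights; this uniformity matters
  because all three will vary with \<open>n\<close>.\<close>

lemma (in prob_space) moment_growth:
  fixes eps :: "(int, 'd::{finite,linorder}) vec \<Rightarrow> 'a \<Rightarrow> real"
  assumes meas[measurable]: "\<And>i. eps i \<in> borel_measurable M" and stat: "strictly_stationary M eps"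
    and q: "0 < q" "q < 2" and C2: "C2 M eps q"
  obtains L where "0 < L"
    and "\<And>m \<Gamma> w W. 1 \<le> m \<Longrightarrow> finite \<Gamma> \<Longrightarrow> 0 \<le> W \<Longrightarrow> (\<And>j. j \<in> \<Gamma> \<Longrightarrow> \<bar>w j\<bar> \<le> W) \<Longrightarrow>
      integrable M (\<lambda>\<omega>. (\<Sum>j\<in>\<Gamma>. w j * eps j \<omega>) ^ (2 * m)) \<and>
      (\<integral>\<omega>. (\<Sum>j\<in>\<Gamma>. w j * eps j \<omega>) ^ (2 * m) \<partial>M)
        \<le> (L * real (card \<Gamma>) * W\<^sup>2 * real (2 * m) powr (2 / q)) ^ m"
proof -
  define \<beta> where "\<beta> = beta_of q"
  have \<beta>: "0 < \<beta>" and q_eq: "1 + 2 / \<beta> = 2 / q"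
    using q by (auto simp: \<beta>_def beta_of_def field_simps)
  define N where "N k = orlicz_norm M \<beta> (\<lambda>\<omega>. sqrt \<bar>eps k \<omega> *
    real_cond_exp M (field_sigma M eps (Vset (idist k 0) 0)) (eps 0) \<omega>\<bar>)" for k
  define I where "I = (\<integral>\<^sup>+k. N k ^ 2 \<partial>count_space (Vset 1 0))"
  have fin0: "orlicz_norm M \<beta> (eps 0) < \<infinity>" and finI: "I < \<infinity>"
    using C2 unfolding C2_def \<beta>_def I_def N_def by auto
  have finN: "N k < \<infinity>" if "k \<in> Vset 1 0" for k
  proof -
    have "N k ^ 2 < \<infinity>"
      using sum_enn2real_le_nn_integral_count_space(2)[OF _ _ finI[unfolded I_def], of "{}"] that by auto
    then show ?thesis by (cases "N k = \<top>") (auto simp: less_top power2_eq_square)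
  qed
  define Y where "Y k \<omega> = eps k \<omega> * real_cond_exp M (field_sigma M eps (Vset (idist k 0) 0)) (eps 0) \<omega>" for k \<omega>
  have [measurable]: "Y k \<in> borel_measurable M" for k unfolding Y_def by measurable
  have sq: "all_moments M (\<lambda>\<omega>. sqrt \<bar>Y k \<omega>\<bar>)"
    "1 \<le> p \<Longrightarrow> (\<integral>\<omega>. \<bar>sqrt \<bar>Y k \<omega>\<bar>\<bar> ^ p \<partial>M) \<le> (orlicz_const \<beta> * real p powr (1 / \<beta>) * enn2real (N k)) ^ p"
    if "k \<in> Vset 1 0" for k p
    using moments_of_finite_orlicz_norm[OF \<beta>, of "\<lambda>\<omega>. sqrt \<bar>Y k \<omega>\<bar>"] finN[OF that]
    by (auto simp: N_def Y_def)
  have Ymom: "all_moments M (Y k)" if "k \<in> Vset 1 0" for k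
  proof -
    have "all_moments M (\<lambda>\<omega>. sqrt \<bar>Y k \<omega>\<bar> * sqrt \<bar>Y k \<omega>\<bar>)" by (intro all_moments_mult sq that)
    then show ?thesis by (simp add: all_moments_def)
  qed
  note eps0 = moments_of_finite_orlicz_norm[OF \<beta> meas fin0]
  interpret moment_field M eps
    by unfold_locales (use meas stat eps0(1) Ymom in \<open>auto simp: Y_def[abs_def]\<close>)
  have ZY: "Z k = Y k" for k by (rule ext) (simp add: Z_def Y_def)
  define N0 where "N0 = enn2real (orlicz_norm M \<beta> (eps 0))"
  define R where "R = N0\<^sup>2 + enn2real I"
  have R: "0 \<le> R" by (simp add: R_def)
  \<comment> \<open>The 4 remains from \<open>8 * m\<close> once \<open>2 * m\<close> has joined the
    power with exponent \<open>2 / \<beta>\<close>. Adding 1 keeps \<open>L\<close> positive when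
    \<open>R = 0\<close>.\<close>
  define L where "L = 4 * (orlicz_const \<beta>)\<^sup>2 * R + 1"
  have L: "0 < L" using R by (auto simp: L_def intro: add_nonneg_pos)
  show ?thesis
  proof (rule that[OF L], intro conjI)
    fix m \<Gamma> and w :: "(int, 'd) vec \<Rightarrow> real" and W
    assume a: "1 \<le> (m::nat)" "finite (\<Gamma> :: (int, 'd) vec set)" "0 \<le> (W::real)" "\<And>j. j \<in> \<Gamma> \<Longrightarrow> \<bar>w j\<bar> \<le> W"
    show "integrable M (\<lambda>\<omega>. (\<Sum>j\<in>\<Gamma>. w j * eps j \<omega>) ^ (2 * m))"
      by (intro all_momentsD(4) all_moments_intros moments)
    define u where "u = (orlicz_const \<beta> * real (2 * m) powr (1 / \<beta>))\<^sup>2"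
    have u: "0 \<le> u" "u = (orlicz_const \<beta>)\<^sup>2 * real (2 * m) powr (2 / \<beta>)"
      by (auto simp: u_def power_mult_distrib power2_eq_square simp flip: powr_add)
    have "(\<integral>\<omega>. (\<Sum>j\<in>\<Gamma>. w j * eps j \<omega>) ^ (2 * m) \<partial>M) \<le> (8 * real m * W\<^sup>2 * (real (card \<Gamma>) * (u * R))) ^ m"
    proof (rule moment_weighted_sum_le[OF a(1,2) _ a(3)])
      show "\<bar>w j\<bar> \<le> W" if "j \<in> \<Gamma>" for j using that by (rule a(4))
      show "0 \<le> u * N0\<^sup>2" "0 \<le> u * (enn2real (N j))\<^sup>2" for j using u by auto
      show "(\<integral>\<omega>. eps 0 \<omega> ^ (2 * m) \<partial>M) \<le> (u * N0\<^sup>2) ^ m"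
        using eps0(2)[of "2 * m"] a(1)
        by (simp add: u_def N0_def power_even_abs flip: power_mult_distrib power_mult)
      \<comment> \<open>The \<open>m\<close>-th moment of \<open>Z j\<close> is the
        \<open>2 m\<close>-th moment of \<open>sqrt \<bar>Z j\<bar>\<close>, so the square of its
        Orlicz norm appears, exactly the summand in (C2).\<close>
      show "(\<integral>\<omega>. \<bar>Z j \<omega>\<bar> ^ m \<partial>M) \<le> (u * (enn2real (N j))\<^sup>2) ^ m" if "j \<in> Vset 1 0" for j
        using sq(2)[OF that, of "2 * m"] a(1)
        by (simp add: u_def ZY power_mult flip: power_mult_distrib)
      show "u * N0\<^sup>2 + (\<Sum>j\<in>A. u * (enn2real (N j))\<^sup>2) \<le> u * R" if A: "finite A" "A \<subseteq> Vset 1 0" for A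
      proof -
        have "(\<Sum>j\<in>A. (enn2real (N j))\<^sup>2) \<le> enn2real I"
          using sum_enn2real_le_nn_integral_count_space(1)[OF A finI[unfolded I_def]]
          by (simp add: I_def power2_eq_square enn2real_mult)
        then show ?thesis
          using u(1) by (simp add: R_def distrib_left mult_left_mono flip: sum_distrib_left)
      qed
    qed
    also have "8 * real m * W\<^sup>2 * (real (card \<Gamma>) * (u * R))
        = 4 * (orlicz_const \<beta>)\<^sup>2 * R * (real (card \<Gamma>) * W\<^sup>2 * (real (2 * m) * real (2 * m) powr (2 / \<beta>)))"
      by (simp add: u(2))
    also have "real (2 * m) * real (2 * m) powr (2 / \<beta>) = real (2 * m) powr (2 / q)"
      using a(1) by (simp add: powr_mult_base q_eq)
    also have "(4 * (orlicz_const \<beta>)\<^sup>2 * R * (real (card \<Gamma>) * W\<^sup>2 * real (2 * m) powr (2 / q))) ^ m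
        \<le> (L * (real (card \<Gamma>) * W\<^sup>2 * real (2 * m) powr (2 / q))) ^ m"
      using R by (intro power_mono mult_right_mono) (auto simp: L_def)
    finally show "(\<integral>\<omega>. (\<Sum>j\<in>\<Gamma>. w j * eps j \<omega>) ^ (2 * m) \<partial>M)
        \<le> (L * real (card \<Gamma>) * W\<^sup>2 * real (2 * m) powr (2 / q)) ^ m"
      by (simp add: mult.assoc)
  qed
qed

text \<open>Markov at order \<open>2 m\<close>. The level exceeds \<open>s\<close> by a constant
  factor, yet the bound decays exponentially in \<open>m\<close>: with \<open>m \<ge> ln n\<close>
  any polynomial order is reached by enlarging \<open>\<kappa>\<close>.\<close>

lemma (in prob_space) tail_of_even_moment:
  assumes S[measurable]: "S \<in> borel_measurable M" and int: "integrable M (\<lambda>\<omega>. S \<omega> ^ (2 * m))"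
    and le: "(\<integral>\<omega>. S \<omega> ^ (2 * m) \<partial>M) \<le> (s\<^sup>2) ^ m" and s: "0 < s"
  shows "measure M {\<omega> \<in> space M. exp \<kappa> * s \<le> \<bar>S \<omega>\<bar>} \<le> exp (- (2 * \<kappa> * real m))"
proof -
  let ?t = "exp \<kappa> * s"
  have t: "0 < ?t" using s by simp
  have "measure M {\<omega> \<in> space M. ?t \<le> \<bar>S \<omega>\<bar>} \<le> measure M {\<omega> \<in> space M. ?t ^ (2 * m) \<le> S \<omega> ^ (2 * m)}"
  proof (rule finite_measure_mono)
    show "{\<omega> \<in> space M. ?t \<le> \<bar>S \<omega>\<bar>} \<subseteq> {\<omega> \<in> space M. ?t ^ (2 * m) \<le> S \<omega> ^ (2 * m)}"
      using t power_mono[of ?t "\<bar>S _\<bar>" "2 * m"] by (auto simp: power_even_abs)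
  qed measurable
  also have "\<dots> \<le> (\<integral>\<omega>. S \<omega> ^ (2 * m) \<partial>M) / ?t ^ (2 * m)"
    using int t by (intro integral_Markov_inequality_measure[where A = "{}"]) auto
  also have "\<dots> \<le> (s\<^sup>2) ^ m / ?t ^ (2 * m)" using le t by (intro divide_right_mono) auto
  also have "\<dots> = 1 / exp \<kappa> ^ (2 * m)" using s by (simp add: power_mult_distrib power_mult)
  also have "\<dots> = exp (- (2 * \<kappa> * real m))"
    by (simp add: exp_minus field_simps flip: exp_of_nat_mult)
  finally show ?thesis .
qed

subsection \<open>Kernel weights and discretisation\<close>

lemma maxnorm_le_iff: "maxnorm x \<le> a \<longleftrightarrow> (\<forall>k. \<bar>x $ k\<bar> \<le> a)"
  unfolding maxnorm_def by (subst Max_le_iff) auto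

lemma
  fixes I :: "'d::finite \<Rightarrow> 'b set"
  assumes "\<And>k. finite (I k)"
  shows finite_vec_box: "finite {v :: ('b, 'd) vec. \<forall>k. v $ k \<in> I k}"
    and card_vec_box: "card {v :: ('b, 'd) vec. \<forall>k. v $ k \<in> I k} = (\<Prod>k\<in>UNIV. card (I k))"
proof -
  have eq: "{v :: ('b, 'd) vec. \<forall>k. v $ k \<in> I k} = vec_lambda ` (PiE UNIV I)"
  proof (intro subset_antisym subsetI)
    fix v :: "('b, 'd) vec" assume "v \<in> {v. \<forall>k. v $ k \<in> I k}"
    then have "v = vec_lambda (\<lambda>k. v $ k)" "(\<lambda>k. v $ k) \<in> PiE UNIV I" by auto
    then show "v \<in> vec_lambda ` (PiE UNIV I)" by blast
  qed auto
  have inj: "inj_on vec_lambda (PiE UNIV I)" by (auto simp: inj_on_def vec_eq_iff)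
  show "finite {v :: ('b, 'd) vec. \<forall>k. v $ k \<in> I k}"
    unfolding eq using assms by (intro finite_imageI finite_PiE) auto
  show "card {v :: ('b, 'd) vec. \<forall>k. v $ k \<in> I k} = (\<Prod>k\<in>UNIV. card (I k))"
    unfolding eq card_image[OF inj] by (rule card_PiE) simp
qed

lemma Lam_eq: "Lam n = {i. \<forall>k. i $ k \<in> {1..int n}}"
  by (auto simp: Lam_def)

lemma finite_Lam: "finite (Lam n)"
  unfolding Lam_eq by (intro finite_vec_box) simp

lemma card_Lam: "card (Lam n :: (int^'d::finite) set) = n ^ CARD('d)"
  unfolding Lam_eq by (subst card_vec_box) auto

definition window :: "nat \<Rightarrow> real \<Rightarrow> real^'d::finite \<Rightarrow> (int^'d) set" where
  "window n h x = {i \<in> Lam n. maxnorm ((1 / h) *\<^sub>R (x - scaled n i)) \<le> 1}"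

lemma finite_window: "finite (window n h x)"
  unfolding window_def by (rule finite_Collect_conjI) (simp add: finite_Lam)

lemma window_eq:
  assumes "0 < n" "0 < h"
  shows "window n h x = {i. \<forall>k. i $ k \<in>
    {max 1 \<lceil>real n * (x $ k - h)\<rceil> .. min (int n) \<lfloor>real n * (x $ k + h)\<rfloor>}}"
proof -
  have "\<bar>1 / h * (y - real_of_int j / real n)\<bar> \<le> 1 \<longleftrightarrow>
      \<lceil>real n * (y - h)\<rceil> \<le> j \<and> j \<le> \<lfloor>real n * (y + h)\<rfloor>" for y j
    using assms by (simp add: abs_mult abs_le_iff le_floor_iff ceiling_le_iff field_simps)
  then show ?thesis
    by (auto simp: window_def Lam_def maxnorm_le_iff scaled_def)
qed

text \<open>Near a face of the cube up to half of the window is cut off. In each coordinate at least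
  \<open>n h - 1\<close> sites remain after rounding, and \<open>n h \<ge> 2\<close> makes this at
  least \<open>n h / 2\<close>.\<close>

lemma card_window_ge:
  fixes x :: "real^'d::finite"
  assumes n: "0 < n" and h: "0 < h" "h \<le> 1" and nh: "2 \<le> real n * h" and x: "x \<in> unit_cube"
  shows "(real n * h / 2) ^ CARD('d) \<le> real (card (window n h x))"
proof -
  let ?I = "\<lambda>k. {max 1 \<lceil>real n * (x $ k - h)\<rceil> .. min (int n) \<lfloor>real n * (x $ k + h)\<rfloor>}"
  have "real n * h / 2 \<le> real (card (?I k))" for k
  proof -
    have 1: "0 \<le> real n * x $ k" "real n * x $ k \<le> real n" "real n * h \<le> real n"
      using x h n by (auto simp: unit_cube_def mult_left_le)
    define l where "l = \<lceil>real n * (x $ k - h)\<rceil>"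
    define u where "u = \<lfloor>real n * (x $ k + h)\<rfloor>"
    have l: "real_of_int l \<le> real n * x $ k - real n * h + 1"
      unfolding l_def right_diff_distrib by linarith
    have u: "real n * x $ k + real n * h - 1 \<le> real_of_int u"
      unfolding u_def distrib_left by linarith
    have "real n * h / 2 \<le> real_of_int (min (int n) u - max 1 l + 1)"
    proof -
      have "real_of_int (min (int n) u) = min (real n) (real_of_int u)"
        "real_of_int (max 1 l) = max 1 (real_of_int l)" by (auto simp: min_def max_def)
      then show ?thesis using 1 l u nh by linarith
    qed
    also have "\<dots> \<le> real (card {max 1 l .. min (int n) u})" by simp
    finally show ?thesis by (simp only: l_def u_def)
  qed
  then have "(\<Prod>k\<in>(UNIV :: 'd set). real n * h / 2) \<le> (\<Prod>k\<in>UNIV. real (card (?I k)))"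
    using n h by (intro prod_mono) auto
  also have "\<dots> = real (card (window n h x))"
    unfolding window_eq[OF n h(1)] by (subst card_vec_box) auto
  finally show ?thesis by simp
qed

definition kernel_weight :: "(real^'d::finite \<Rightarrow> real) \<Rightarrow> nat \<Rightarrow> real \<Rightarrow> real^'d \<Rightarrow> int^'d \<Rightarrow> real" where
  "kernel_weight K n h x i = K ((1 / h) *\<^sub>R (x - scaled n i)) / (\<Sum>j\<in>Lam n. K ((1 / h) *\<^sub>R (x - scaled n j)))"

text \<open>At a fixed point the regression part is deterministic and disappears on centring. If the
  normalising sum vanishes, both sides are 0 because division by 0 gives 0.\<close>

lemma gn_centered:
  fixes eps :: "int^'d::finite \<Rightarrow> 'a \<Rightarrow> real"
  assumes "prob_space M" "\<And>i. integrable M (eps i)" "\<And>i. integral\<^sup>L M (eps i) = 0"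
  shows "gn eps g K h n x \<omega> - integral\<^sup>L M (gn eps g K h n x)
    = (\<Sum>i\<in>Lam n. kernel_weight K n (h n) x i * eps i \<omega>)"
proof -
  interpret prob_space M by fact
  define G where "G = (\<Sum>i\<in>Lam n. kernel_weight K n (h n) x i * g (scaled n i))"
  have eq: "gn eps g K h n x \<omega> = G + (\<Sum>i\<in>Lam n. kernel_weight K n (h n) x i * eps i \<omega>)" for \<omega>
    by (simp add: gn_def G_def kernel_weight_def sum_divide_distrib algebra_simps add_divide_distrib
        flip: sum.distrib)
  have "integral\<^sup>L M (gn eps g K h n x) = G"
    unfolding eq[abs_def] using assms by (simp add: prob_space)
  then show ?thesis by (simp add: eq)
qed

locale bounded_kernel =
  fixes K :: "real^'d::finite \<Rightarrow> real" and \<eta> c C :: real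
  assumes supp: "\<And>x. K x \<noteq> 0 \<Longrightarrow> maxnorm x \<le> 1"
    and \<eta>: "0 < \<eta>" "\<And>x y. maxnorm x \<le> 1 \<Longrightarrow> maxnorm y \<le> 1 \<Longrightarrow> \<bar>K x - K y\<bar> \<le> \<eta> * maxnorm (x - y)"
    and c: "0 < c" "\<And>x. maxnorm x \<le> 1 \<Longrightarrow> c \<le> K x"
    and C: "0 < C" "\<And>x. maxnorm x \<le> 1 \<Longrightarrow> K x \<le> C"
begin

abbreviation Kv :: "nat \<Rightarrow> real \<Rightarrow> real^'d \<Rightarrow> int^'d \<Rightarrow> real" where
  "Kv n h x i \<equiv> K ((1 / h) *\<^sub>R (x - scaled n i))"

lemma kernel_weight_outside: "i \<in> Lam n \<Longrightarrow> i \<notin> window n h x \<Longrightarrow> kernel_weight K n h x i = 0"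
  using supp by (auto simp: kernel_weight_def window_def)

lemma kernel_weight_eq: "kernel_weight K n h x i = Kv n h x i / (\<Sum>j\<in>window n h x. Kv n h x j)"
proof -
  have "(\<Sum>j\<in>Lam n. Kv n h x j) = (\<Sum>j\<in>window n h x. Kv n h x j)"
    using supp by (intro sum.mono_neutral_right finite_Lam) (auto simp: window_def)
  then show ?thesis by (simp add: kernel_weight_def)
qed

lemma sum_kernel_eq_window:
  "(\<Sum>i\<in>Lam n. kernel_weight K n h x i * f i) = (\<Sum>i\<in>window n h x. kernel_weight K n h x i * f i)"
  using kernel_weight_outside by (intro sum.mono_neutral_right finite_Lam) (auto simp: window_def)

lemma window_sum_ge: "c * real (card (window n h x)) \<le> (\<Sum>j\<in>window n h x. Kv n h x j)"
  using sum_mono[of "window n h x" "\<lambda>_. c" "Kv n h x"] c(2) by (simp add: window_def mult.commute)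

text \<open>On its window the kernel lies between \<open>c\<close> and \<open>C\<close>, so the
  weights are comparable to those of a plain average.\<close>

lemma abs_kernel_weight_le:
  assumes "i \<in> window n h x"
  shows "\<bar>kernel_weight K n h x i\<bar> \<le> C / (c * real (card (window n h x)))"
proof -
  have "0 < card (window n h x)" using assms finite_window by (auto simp: card_gt_0_iff)
  then have pos: "0 < c * real (card (window n h x))" using c by simp
  have k: "c \<le> Kv n h x i" "Kv n h x i \<le> C" using assms c(2) C(2) by (auto simp: window_def)
  have "Kv n h x i / (\<Sum>j\<in>window n h x. Kv n h x j) \<le> C / (c * real (card (window n h x)))"
    using k pos c(1) C(1) window_sum_ge by (intro frac_le) auto
  moreover have "0 \<le> Kv n h x i / (\<Sum>j\<in>window n h x. Kv n h x j)"
    using k pos c(1) window_sum_ge[of n h x] by simp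
  ultimately show ?thesis by (simp add: kernel_weight_eq)
qed

text \<open>With a common window the kernel is compared only inside its support, where it is
  Lipschitz. The two parts of the constant come from varying the numerator and the normalising sum;
  a further factor of one over the window size is given up.\<close>

lemma kernel_weight_diff_le:
  assumes h: "0 < h" and same: "window n h y = window n h x"
    and close: "\<And>k. \<bar>x $ k - y $ k\<bar> \<le> \<delta>" and i: "i \<in> Lam n"
  shows "\<bar>kernel_weight K n h x i - kernel_weight K n h y i\<bar> \<le> (1 / c + C / c\<^sup>2) * (\<eta> * (\<delta> / h))"
proof -
  have \<delta>: "0 \<le> \<delta>" using close[of undefined] by linarith
  define D where "D = \<eta> * (\<delta> / h)"
  have D: "0 \<le> D" using \<delta> h \<eta> by (simp add: D_def)
  show ?thesis
  proof (cases "i \<in> window n h x")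
    case False
    then show ?thesis using kernel_weight_outside[OF i] same D c(1) C(1) unfolding D_def[symmetric] by simp
  next
    case True
    define N where "N = real (card (window n h x))"
    have N: "1 \<le> N" using True finite_window[of n h x] by (auto simp: N_def Suc_le_eq card_gt_0_iff)
    define s where "s = (\<Sum>j\<in>window n h x. Kv n h x j)"
    define s' where "s' = (\<Sum>j\<in>window n h x. Kv n h y j)"
    have s: "c * N \<le> s" "c * N \<le> s'"
      using window_sum_ge[of n h x] window_sum_ge[of n h y] by (auto simp: s_def s'_def N_def same)
    have cN: "0 < c * N" using c N by simp
    then have s0: "0 < s" "0 < s'" using s by linarith+
    have diff: "\<bar>Kv n h x j - Kv n h y j\<bar> \<le> D" if j: "j \<in> window n h x" for j
    proof -
      have j': "j \<in> window n h y" using j same by simp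
      have "\<bar>Kv n h x j - Kv n h y j\<bar>
          \<le> \<eta> * maxnorm ((1 / h) *\<^sub>R (x - scaled n j) - (1 / h) *\<^sub>R (y - scaled n j))"
        using j j' by (intro \<eta>(2)) (auto simp: window_def)
      also have "(1 / h) *\<^sub>R (x - scaled n j) - (1 / h) *\<^sub>R (y - scaled n j) = (1 / h) *\<^sub>R (x - y)"
        by (simp flip: scaleR_diff_right)
      also have "maxnorm ((1 / h) *\<^sub>R (x - y)) \<le> \<delta> / h"
        using close h by (auto simp: maxnorm_le_iff abs_mult divide_right_mono)
      finally show ?thesis using \<eta>(1) by (simp add: D_def)
    qed
    have ss: "\<bar>s' - s\<bar> \<le> N * D"
    proof -
      have "\<bar>s - s'\<bar> \<le> (\<Sum>j\<in>window n h x. D)"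
        unfolding s_def s'_def sum_subtractf[symmetric]
        by (rule order_trans[OF sum_abs sum_mono[OF diff]])
      then show ?thesis by (simp add: N_def abs_minus_commute)
    qed
    have "i \<in> window n h y" using True same by simp
    then have my: "maxnorm ((1 / h) *\<^sub>R (y - scaled n i)) \<le> 1" by (simp add: window_def)
    have k: "0 \<le> Kv n h y i" "Kv n h y i \<le> C" using c(1) c(2)[OF my] C(2)[OF my] by linarith+
    have "kernel_weight K n h x i - kernel_weight K n h y i = Kv n h x i / s - Kv n h y i / s'"
      by (simp add: kernel_weight_eq s_def s'_def same)
    also have "\<dots> = (Kv n h x i - Kv n h y i) / s + Kv n h y i * (s' - s) / (s * s')"
      using s0 by (simp add: field_simps)
    finally have "\<bar>kernel_weight K n h x i - kernel_weight K n h y i\<bar>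
        \<le> \<bar>Kv n h x i - Kv n h y i\<bar> / s + Kv n h y i * \<bar>s' - s\<bar> / (s * s')"
      using s0 k by (simp add: abs_mult abs_divide order_trans[OF abs_triangle_ineq])
    also have "\<dots> \<le> D / (c * N) + C * (N * D) / ((c * N) * (c * N))"
      using s s0 cN k diff[OF True] ss C(1) D N
      by (intro add_mono frac_le mult_mono) auto
    also have "\<dots> = (1 / c + C / c\<^sup>2) * D / N"
      using c N by (simp add: field_simps power2_eq_square)
    also have "\<dots> \<le> (1 / c + C / c\<^sup>2) * D"
    proof -
      have "0 \<le> (1 / c + C / c\<^sup>2) * D" using c(1) C(1) D by simp
      from mult_left_mono[OF N this] show ?thesis using N by (simp add: divide_le_eq)
    qed
    finally show ?thesis by (simp add: D_def)
  qed
qed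

end

section \<open>A net adapted to the windows\<close>

lemma exists_representatives:
  assumes "finite F" "f ` U \<subseteq> F"
  shows "\<exists>Q\<subseteq>U. finite Q \<and> card Q \<le> card F \<and> (\<forall>x\<in>U. \<exists>y\<in>Q. f y = f x)"
proof (intro exI conjI ballI)
  let ?Q = "inv_into U f ` f ` U"
  have fin: "finite (f ` U)" using assms finite_subset by blast
  show "?Q \<subseteq> U" by (auto intro: inv_into_into)
  show "finite ?Q" using fin by simp
  show "card ?Q \<le> card F"
    using card_image_le[OF fin, of "inv_into U f"] card_mono[OF assms] by linarith
  show "\<exists>y\<in>?Q. f y = f x" if "x \<in> U" for x
    using that by (intro bexI[of _ "inv_into U f (f x)"]) (auto intro: f_inv_into_f)
qed

text \<open>The kernel jumps at the boundary of its support, so points of one cell have to see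
  exactly the same sites. This costs only polynomially many cells, since
  the window of \<open>x\<close> is fixed by two integers per coordinate.\<close>
lemma exists_net:
  assumes n: "4 \<le> n" and h: "0 < h" "h \<le> 1" and r: "1 \<le> r"
  shows "\<exists>Q\<subseteq>(unit_cube :: (real^'d::finite) set). finite Q \<and> card Q \<le> n ^ (3 * (r + 1) * CARD('d)) \<and>
    (\<forall>x\<in>unit_cube. \<exists>y\<in>Q. window n h y = window n h x \<and> (\<forall>k. \<bar>x $ k - y $ k\<bar> \<le> 1 / real n ^ r))"
proof -
  \<comment> \<open>A common range for three integers per coordinate: the rounded window ends lie
    between \<open>- n\<close> and \<open>2 * n\<close>, the cell number between 0 and
    \<open>n ^ r\<close>, and \<open>r \<ge> 1\<close> gives \<open>n \<le> n ^ r\<close>.\<close>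
  define J where "J = {- (int n ^ r) .. 2 * int n ^ r}"
  define F where "F = PiE (UNIV :: 'd set) (\<lambda>_. J \<times> J \<times> J)"
  define f where "f x k = (\<lceil>real n * (x $ k - h)\<rceil>, \<lfloor>real n * (x $ k + h)\<rfloor>, \<lfloor>real n ^ r * x $ k\<rfloor>)"
    for x :: "real^'d" and k
  have nr: "real n \<le> real n ^ r" using n r by (intro self_le_power) auto
  have F: "f ` unit_cube \<subseteq> F"
  proof safe
    fix x :: "real^'d" assume x: "x \<in> unit_cube"
    have "f x k \<in> J \<times> J \<times> J" for k
    proof -
      have 1: "0 \<le> real n * x $ k" "real n * x $ k \<le> real n" "real n * h \<le> real n" "0 \<le> real n * h"
        "0 \<le> real n ^ r * x $ k" "real n ^ r * x $ k \<le> real n ^ r"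
        using x h n by (auto simp: unit_cube_def mult_left_le)
      have in_J: "j \<in> J" if "- (real n ^ r) \<le> real_of_int j" "real_of_int j \<le> 2 * real n ^ r" for j
      proof -
        have "real_of_int (- (int n ^ r)) \<le> real_of_int j" "real_of_int j \<le> real_of_int (2 * int n ^ r)"
          using that by auto
        then show ?thesis unfolding J_def atLeastAtMost_iff of_int_le_iff by blast
      qed
      have "- (real n ^ r) \<le> real_of_int \<lceil>real n * (x $ k - h)\<rceil>"
        using 1 nr unfolding right_diff_distrib by linarith
      moreover have "\<lceil>real n * (x $ k - h)\<rceil> \<le> int n"
        using 1 by (subst ceiling_le_iff) (simp add: right_diff_distrib)
      moreover have "0 \<le> \<lfloor>real n * (x $ k + h)\<rfloor>"
        using 1 by (subst le_floor_iff) (simp add: distrib_left)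
      moreover have "real_of_int \<lfloor>real n * (x $ k + h)\<rfloor> \<le> 2 * real n ^ r"
        using 1 nr unfolding distrib_left by linarith
      moreover have "0 \<le> \<lfloor>real n ^ r * x $ k\<rfloor>"
        using 1 by (subst le_floor_iff) simp
      moreover have "real_of_int \<lfloor>real n ^ r * x $ k\<rfloor> \<le> real n ^ r"
        using 1 by linarith
      ultimately show ?thesis
        using nr n unfolding f_def mem_Times_iff fst_conv snd_conv
        by (intro conjI in_J) linarith+
    qed
    then show "f x \<in> F" by (auto simp: F_def)
  qed
  \<comment> \<open>\<open>n \<ge> 4\<close> absorbs the constant, which leaves a pure power of
    \<open>n\<close>.\<close>
  have cardJ: "card J \<le> n ^ (r + 1)"
  proof -
    have "card J = 3 * n ^ r + 1"
    proof -
      have "card J = nat (int (3 * n ^ r + 1))" by (simp add: J_def)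
      then show ?thesis by (simp only: nat_int)
    qed
    also have "\<dots> \<le> 4 * n ^ r" using n by simp
    also have "\<dots> \<le> n * n ^ r" using n by (intro mult_right_mono) auto
    finally show ?thesis by simp
  qed
  have "card F = (card J * (card J * card J)) ^ CARD('d)"
    unfolding F_def by (subst card_PiE) (auto simp: card_cartesian_product)
  also have "\<dots> \<le> (n ^ (r + 1) * (n ^ (r + 1) * n ^ (r + 1))) ^ CARD('d)"
    using cardJ by (intro power_mono mult_mono) auto
  also have "\<dots> = n ^ (3 * (r + 1) * CARD('d))"
    unfolding power_add[symmetric] power_mult[symmetric] by (rule arg_cong[of _ _ "power n"]) (simp add: algebra_simps)
  finally have cardF: "card F \<le> n ^ (3 * (r + 1) * CARD('d))" .
  \<comment> \<open>Not every code in \<open>F\<close> occurs for a point of the cube. One point is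
    chosen per code that occurs, which keeps the net inside the cube, where the lower bound on
    window sizes is available.\<close>
  have "finite F" by (auto simp: F_def J_def intro!: finite_PiE)
  from exists_representatives[OF this F] obtain Q where Q: "Q \<subseteq> unit_cube" "finite Q" "card Q \<le> card F"
    "\<And>x. x \<in> unit_cube \<Longrightarrow> \<exists>y\<in>Q. f y = f x" by blast
  show ?thesis
  proof (intro exI conjI ballI)
    show "Q \<subseteq> unit_cube" "finite Q" by fact+
    show "card Q \<le> n ^ (3 * (r + 1) * CARD('d))" using Q(3) cardF by linarith
    fix x :: "real^'d" assume "x \<in> unit_cube"
    then obtain y where y: "y \<in> Q" "f y = f x" using Q(4) by blast
    have eq: "\<lceil>real n * (y $ k - h)\<rceil> = \<lceil>real n * (x $ k - h)\<rceil>"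
      "\<lfloor>real n * (y $ k + h)\<rfloor> = \<lfloor>real n * (x $ k + h)\<rfloor>"
      "\<lfloor>real n ^ r * y $ k\<rfloor> = \<lfloor>real n ^ r * x $ k\<rfloor>" for k
      using fun_cong[OF y(2), of k] by (auto simp: f_def)
    have "window n h y = window n h x"
      using n h by (simp add: window_eq eq)
    moreover have "\<bar>x $ k - y $ k\<bar> \<le> 1 / real n ^ r" for k
    proof -
      have "\<bar>real n ^ r * x $ k - real n ^ r * y $ k\<bar> \<le> 1" using eq(3)[of k] by linarith
      then have "real n ^ r * \<bar>x $ k - y $ k\<bar> \<le> 1"
        using n by (simp add: abs_mult flip: right_diff_distrib)
      then show ?thesis using n by (simp add: field_simps)
    qed
    ultimately show "\<exists>y\<in>Q. window n h y = window n h x \<and> (\<forall>k. \<bar>x $ k - y $ k\<bar> \<le> 1 / real n ^ r)"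
      using y(1) by blast
  qed
qed

subsection \<open>Almost sure rate\<close>

text \<open>Used with \<open>t = 2 * m\<close>, \<open>a = n h_n\<close>, \<open>l = ln n\<close>
  and \<open>N\<close> the window size.\<close>

lemma rate_le:
  fixes a l N q t :: real
  assumes "0 < a" "(a / 2) ^ d \<le> N" "0 < q" "0 \<le> t" "t \<le> 4 * l"
  shows "t powr (1 / q) / sqrt N
    \<le> 2 powr (real d / 2) * 4 powr (1 / q) * (l powr (1 / q) / a powr (real d / 2))"
proof -
  have l: "0 \<le> l" using assms by linarith
  have "(a / 2) powr (real d / 2) = sqrt ((a / 2) ^ d)"
    using assms by (simp add: powr_powr flip: powr_half_sqrt powr_realpow)
  also have "\<dots> \<le> sqrt N" using assms by simp
  finally have N: "(a / 2) powr (real d / 2) \<le> sqrt N" .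
  have "t powr (1 / q) / sqrt N \<le> (4 * l) powr (1 / q) / (a / 2) powr (real d / 2)"
    using assms N by (intro frac_le powr_mono2) auto
  also have "\<dots> = 2 powr (real d / 2) * 4 powr (1 / q) * (l powr (1 / q) / a powr (real d / 2))"
    using assms l by (simp add: powr_mult powr_divide)
  finally show ?thesis .
qed

theorem theorem1:
  fixes M :: "'a measure"
    and eps :: "(int, 'd::{finite,linorder}) vec \<Rightarrow> 'a \<Rightarrow> real"
    and g :: "(real, 'd) vec \<Rightarrow> real"
    and K :: "(real, 'd) vec \<Rightarrow> real"
    and h :: "nat \<Rightarrow> real"
    and q :: real
  assumes "prob_space M"
    and "\<And>i. eps i \<in> borel_measurable M"
    and "strictly_stationary M eps"
    and "integrable M (eps 0)" and "integral\<^sup>L M (eps 0) = 0"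
    and "prob_density K" and "A1 K"
    and "\<And>n. h n > 0" and "h \<longlonglongrightarrow> 0"
    and "filterlim (\<lambda>n. real n * h n) at_top sequentially"
    and "0 < q" and "q < 2" and "C2 M eps q"
  shows "\<exists>lam>0. AE \<omega> in M.
           limsup (\<lambda>n. (SUP x\<in>unit_cube. ereal \<bar>gn eps g K h n x \<omega> - integral\<^sup>L M (gn eps g K h n x)\<bar>)
                        / ereal (ln (real n) powr (1 / q) / (real n * h n) powr (real CARD('d) / 2)))
           \<le> ereal lam"
proof -
  interpret prob_space M by fact
  note [measurable] = assms(2)
  note hpos = assms(8)
  obtain \<eta> c C where "bounded_kernel K \<eta> c C"
    using assms(7) unfolding A1_def bounded_kernel_def by metis
  then interpret bounded_kernel K \<eta> c C .
  obtain L where L: "0 < L" and growth: "\<And>m \<Gamma> w W. 1 \<le> m \<Longrightarrow> finite \<Gamma> \<Longrightarrow> 0 \<le> W \<Longrightarrow>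
      (\<And>j. j \<in> \<Gamma> \<Longrightarrow> \<bar>w j\<bar> \<le> W) \<Longrightarrow>
      integrable M (\<lambda>\<omega>. (\<Sum>j\<in>\<Gamma>. w j * eps j \<omega>) ^ (2 * m)) \<and>
      (\<integral>\<omega>. (\<Sum>j\<in>\<Gamma>. w j * eps j \<omega>) ^ (2 * m) \<partial>M)
        \<le> (L * real (card \<Gamma>) * W\<^sup>2 * real (2 * m) powr (2 / q)) ^ m"
    using moment_growth[OF assms(2,3,11,12,13)] by blast
  have eps_int: "integrable M (eps i)" and eps_mean: "integral\<^sup>L M (eps i) = 0"
    and eps_abs: "(\<integral>\<omega>. \<bar>eps i \<omega>\<bar> \<partial>M) = (\<integral>\<omega>. \<bar>eps 0 \<omega>\<bar> \<partial>M)" for i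
  proof -
    note d = stationary_distr[OF assms(3,2), of i]
    have "integrable (distr M borel (eps 0)) (\<lambda>x. x)"
      using assms(4) by (subst integrable_distr_eq) auto
    then show "integrable M (eps i)" unfolding d by (subst (asm) integrable_distr_eq) auto
    have "integral\<^sup>L (distr M borel (eps 0)) (\<lambda>x. x) = 0"
      using assms(5) by (subst integral_distr) auto
    then show "integral\<^sup>L M (eps i) = 0" unfolding d by (subst (asm) integral_distr) auto
    have "integral\<^sup>L (distr M borel (eps 0)) (\<lambda>x. \<bar>x\<bar>) = integral\<^sup>L (distr M borel (eps i)) (\<lambda>x. \<bar>x\<bar>)"
      unfolding d ..
    then show "(\<integral>\<omega>. \<bar>eps i \<omega>\<bar> \<partial>M) = (\<integral>\<omega>. \<bar>eps 0 \<omega>\<bar> \<partial>M)"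
      by (subst (asm) (1 2) integral_distr) auto
  qed
  define S where "S n x \<omega> = (\<Sum>i\<in>Lam n. kernel_weight K n (h n) x i * eps i \<omega>)" for n x \<omega>
  have S_meas[measurable]: "S n x \<in> borel_measurable M" for n x unfolding S_def by measurable
  have centered: "gn eps g K h n x \<omega> - integral\<^sup>L M (gn eps g K h n x) = S n x \<omega>" for n x \<omega>
    unfolding S_def by (rule gn_centered[OF assms(1) eps_int eps_mean])
  define d where "d = CARD('d)"
  \<comment> \<open>Moving to a net point costs \<open>n ^ (d + 2)\<close> for the sum of all
    \<open>\<bar>eps i\<bar>\<close> and at most \<open>n\<close> for the factor
    \<open>1 / h n\<close>; the remaining \<open>n ^ d\<close> brings the error below the
    rate.\<close>
  define r where "r = 2 * d + 3"
  define E where "E = 3 * (r + 1) * d"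
  \<comment> \<open>The tail at a point becomes \<open>1 / n ^ (E + 2)\<close>, so a union over at
    most \<open>n ^ E\<close> net points leaves the summable \<open>1 / n ^ 2\<close>.\<close>
  define \<kappa> where "\<kappa> = real (E + 2) / 2"
  define rate where "rate n = ln (real n) powr (1 / q) / (real n * h n) powr (real d / 2)" for n
  define lam1 where "lam1 = exp \<kappa> * (sqrt L * (C / c) * (2 powr (real d / 2) * 4 powr (1 / q)))"
  define lam2 where "lam2 = (1 / c + C / c\<^sup>2) * \<eta>"
  have lam: "0 < lam1" "0 < lam2"
    using L c(1) C(1) \<eta>(1) by (auto simp: lam1_def lam2_def intro!: mult_pos_pos add_pos_pos)
  \<comment> \<open>\<open>n \<ge> 4\<close> gives \<open>ln n \<ge> 1\<close> and is required for
    counting the net; the other two conditions are those of the window count.\<close>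
  define good where "good n \<longleftrightarrow> 4 \<le> n \<and> h n \<le> 1 \<and> 2 \<le> real n * h n" for n
  have "eventually (\<lambda>n. h n < 1) sequentially" using assms(9) by (rule order_tendstoD) simp
  moreover have "eventually (\<lambda>n. 2 \<le> real n * h n) sequentially"
    using assms(10) by (simp add: filterlim_at_top)
  ultimately have good: "eventually good sequentially"
    using eventually_ge_at_top[of 4] by eventually_elim (simp add: good_def)
  have ln1: "1 \<le> ln (real n)" if "good n" for n
    using that exp_le by (subst ln_ge_iff) (auto simp: good_def intro: order_trans)
  \<comment> \<open>A crude lower bound, which reduces the treatment of the discretisation error to
    comparing powers of \<open>n\<close>.\<close>
  have rate_ge: "1 / real n ^ d \<le> rate n" if "good n" for n
  proof -
    have n: "4 \<le> real n" "real n * h n \<le> real n" "0 < real n * h n"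
      using that hpos[of n] by (auto simp: good_def mult_left_le)
    have "(real n * h n) powr (real d / 2) \<le> real n powr (real d / 2)"
      using n by (intro powr_mono2) auto
    also have "\<dots> \<le> real n powr (real d)" using n by (intro powr_mono) auto
    also have "\<dots> = real n ^ d" using n by (simp add: powr_realpow)
    finally have "(real n * h n) powr (real d / 2) \<le> real n ^ d" .
    moreover have "1 \<le> ln (real n) powr (1 / q)" using ln1[OF that] assms(11) by (intro ge_one_powr_ge_zero) auto
    ultimately show ?thesis unfolding rate_def using n by (intro frac_le) auto
  qed
  have tail: "measure M {\<omega> \<in> space M. lam1 * rate n \<le> \<bar>S n x \<omega>\<bar>} \<le> 1 / real n ^ (E + 2)"
    if n: "good n" and x: "x \<in> unit_cube" for n x
  proof -
    define N where "N = real (card (window n (h n) x))"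
    \<comment> \<open>Rounding up secures \<open>m \<ge> ln n\<close> for the tail; because
      \<open>ln n \<ge> 1\<close>, it at most doubles the order.\<close>
    define m where "m = nat \<lceil>ln (real n)\<rceil>"
    have n0: "0 < n" "0 < real n * h n" using n hpos[of n] by (auto simp: good_def)
    have N: "(real n * h n / 2) ^ d \<le> N"
      unfolding N_def d_def using n x hpos[of n] by (intro card_window_ge) (auto simp: good_def)
    have "0 < (real n * h n / 2) ^ d" using n0 by simp
    then have N0: "0 < N" using N by linarith
    have m: "1 \<le> m" "ln (real n) \<le> real m" "real (2 * m) \<le> 4 * ln (real n)"
      using ln1[OF n] unfolding m_def by linarith+
    define W where "W = C / (c * N)"
    have W: "0 < W" using c(1) C(1) N0 by (simp add: W_def)
    \<comment> \<open>The square root of the base in \<open>growth\<close>: for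
      \<open>W = C / (c * N)\<close> one has \<open>N * W^2 = (C / c)^2 / N\<close>, the scale of
      the variance of an average over \<open>N\<close> sites.\<close>
    define s where "s = sqrt L * (C / c) * (real (2 * m) powr (1 / q) / sqrt N)"
    have s0: "0 < s" using L c(1) C(1) N0 m by (simp add: s_def)
    have s2: "L * N * W\<^sup>2 * real (2 * m) powr (2 / q) = s\<^sup>2"
    proof -
      have "(real (2 * m) powr (1 / q))\<^sup>2 = real (2 * m) powr (2 / q)"
        by (simp add: power2_eq_square flip: powr_add)
      then show ?thesis using N0 L c(1)
        by (simp add: s_def W_def power_mult_distrib power_divide) (simp add: field_simps power2_eq_square)
    qed
    have SW: "S n x \<omega> = (\<Sum>i\<in>window n (h n) x. kernel_weight K n (h n) x i * eps i \<omega>)" for \<omega>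
      unfolding S_def by (rule sum_kernel_eq_window)
    have "integrable M (\<lambda>\<omega>. S n x \<omega> ^ (2 * m)) \<and> (\<integral>\<omega>. S n x \<omega> ^ (2 * m) \<partial>M) \<le> (s\<^sup>2) ^ m"
      unfolding SW s2[symmetric] N_def using m(1) W
      by (intro growth finite_window) (auto simp: W_def N_def abs_kernel_weight_le)
    then have "measure M {\<omega> \<in> space M. exp \<kappa> * s \<le> \<bar>S n x \<omega>\<bar>} \<le> exp (- (2 * \<kappa> * real m))"
      using s0 by (intro tail_of_even_moment) auto
    moreover have "exp \<kappa> * s \<le> lam1 * rate n"
    proof -
      have "real (2 * m) powr (1 / q) / sqrt N \<le> 2 powr (real d / 2) * 4 powr (1 / q) * rate n"
        unfolding rate_def using N n0 m assms(11) by (intro rate_le) auto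
      then have "exp \<kappa> * s \<le> exp \<kappa> * (sqrt L * (C / c) * (2 powr (real d / 2) * 4 powr (1 / q) * rate n))"
        unfolding s_def using L c(1) C(1) by (intro mult_left_mono) auto
      then show ?thesis by (simp add: lam1_def mult.assoc)
    qed
    then have "measure M {\<omega> \<in> space M. lam1 * rate n \<le> \<bar>S n x \<omega>\<bar>}
        \<le> measure M {\<omega> \<in> space M. exp \<kappa> * s \<le> \<bar>S n x \<omega>\<bar>}"
      by (intro finite_measure_mono) (auto, measurable)
    moreover have "exp (- (2 * \<kappa> * real m)) \<le> 1 / real n ^ (E + 2)"
    proof -
      have "2 * \<kappa> = real (E + 2)" by (simp add: \<kappa>_def)
      then have "exp (- (2 * \<kappa> * real m)) \<le> exp (- (real (E + 2) * ln (real n)))"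
        unfolding exp_le_cancel_iff neg_le_iff_le using m(2) by (metis mult_left_mono of_nat_0_le_iff)
      also have "\<dots> = 1 / real n ^ (E + 2)"
        using n0 by (simp only: exp_minus exp_of_nat_mult exp_ln of_nat_0_less_iff inverse_eq_divide)
      finally show ?thesis .
    qed
    ultimately show ?thesis by linarith
  qed
  define E1 where "E1 = (\<integral>\<omega>. \<bar>eps 0 \<omega>\<bar> \<partial>M)"
  \<comment> \<open>The mean is of order \<open>n ^ d\<close>; a level larger by
    \<open>n ^ 2\<close> makes the probabilities summable using first moments alone.\<close>
  have crude: "measure M {\<omega> \<in> space M. real n ^ (d + 2) \<le> (\<Sum>i\<in>Lam n. \<bar>eps i \<omega>\<bar>)} \<le> E1 / real n ^ 2"
    if "good n" for n
  proof -
    have n: "0 < real n" using that by (simp add: good_def)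
    have "measure M {\<omega> \<in> space M. real n ^ (d + 2) \<le> (\<Sum>i\<in>Lam n. \<bar>eps i \<omega>\<bar>)}
        \<le> (\<integral>\<omega>. (\<Sum>i\<in>Lam n. \<bar>eps i \<omega>\<bar>) \<partial>M) / real n ^ (d + 2)"
      using n eps_int by (intro integral_Markov_inequality_measure[where A = "{}"]) (auto intro!: sum_nonneg)
    also have "(\<integral>\<omega>. (\<Sum>i\<in>Lam n. \<bar>eps i \<omega>\<bar>) \<partial>M) = (\<Sum>i\<in>Lam n. (\<integral>\<omega>. \<bar>eps i \<omega>\<bar> \<partial>M))"
      using eps_int by (intro Bochner_Integration.integral_sum) auto
    also have "\<dots> = (\<Sum>i\<in>(Lam n :: (int, 'd) vec set). E1)" unfolding E1_def by (intro sum.cong refl eps_abs)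
    also have "\<dots> = real n ^ d * E1" by (simp add: card_Lam d_def)
    also have "real n ^ d * E1 / real n ^ (d + 2) = E1 / real n ^ 2"
      using n by (simp add: power_add power2_eq_square)
    finally show ?thesis .
  qed
  define net where "net n Q \<longleftrightarrow> finite Q \<and> card Q \<le> n ^ E \<and>
    (\<forall>x\<in>unit_cube. \<exists>y\<in>Q. window n (h n) y = window n (h n) x \<and> (\<forall>k. \<bar>x $ k - y $ k\<bar> \<le> 1 / real n ^ r))"
    for n and Q :: "(real, 'd) vec set"
  have "\<exists>Q\<subseteq>unit_cube. net n Q" if "good n" for n
    unfolding net_def E_def d_def
    by (rule exists_net) (use that hpos in \<open>auto simp: good_def r_def\<close>)
  then obtain Q where Q: "\<And>n. good n \<Longrightarrow> Q n \<subseteq> unit_cube" and netQ: "\<And>n. good n \<Longrightarrow> net n (Q n)"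
    by metis
  define B where "B n = (\<Union>x\<in>Q n. {\<omega> \<in> space M. lam1 * rate n \<le> \<bar>S n x \<omega>\<bar>})" for n
  define B' where "B' n = {\<omega> \<in> space M. real n ^ (d + 2) \<le> (\<Sum>i\<in>Lam n. \<bar>eps i \<omega>\<bar>)}" for n
  \<comment> \<open>For the finitely many \<open>n\<close> that are not \<open>good\<close>, nothing
    is known about \<open>Q n\<close>; the empty event keeps all \<open>A n\<close>
    measurable.\<close>
  define A where "A n = (if good n then B n \<union> B' n else {})" for n
  have B_sets: "B n \<in> sets M" if "good n" for n
    unfolding B_def using netQ[OF that] by (intro sets.finite_UN) (auto simp: net_def)
  have B'_sets: "B' n \<in> sets M" for n unfolding B'_def by measurable
  have A_sets: "A n \<in> sets M" for n using B_sets B'_sets by (auto simp: A_def)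
  have A_le: "measure M (A n) \<le> (1 + E1) / real n ^ 2" if n: "good n" for n
  proof -
    have n0: "0 < real n" using n by (simp add: good_def)
    have "measure M (B n) \<le> (\<Sum>x\<in>Q n. measure M {\<omega> \<in> space M. lam1 * rate n \<le> \<bar>S n x \<omega>\<bar>})"
      unfolding B_def using netQ[OF n] by (intro finite_measure_subadditive_finite) (auto simp: net_def)
    also have "\<dots> \<le> (\<Sum>x\<in>Q n. 1 / real n ^ (E + 2))"
      using Q[OF n] by (intro sum_mono tail[OF n]) auto
    also have "\<dots> = real (card (Q n)) * (1 / real n ^ (E + 2))" by simp
    also have "\<dots> \<le> real n ^ E * (1 / real n ^ (E + 2))"
      using netQ[OF n] by (intro mult_right_mono) (auto simp: net_def simp flip: of_nat_power)
    also have "\<dots> = 1 / real n ^ 2" using n0 by (simp add: power_add power2_eq_square)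
    finally have "measure M (B n) \<le> 1 / real n ^ 2" .
    moreover have "measure M (A n) \<le> measure M (B n) + measure M (B' n)"
      using n B_sets[OF n] B'_sets[of n] unfolding A_def by (simp add: measure_Un_le)
    ultimately show ?thesis using crude[OF n] by (simp add: B'_def add_divide_distrib)
  qed
  have "summable (\<lambda>n. measure M (A n))"
  proof (rule summable_comparison_test_ev)
    show "eventually (\<lambda>n. norm (measure M (A n)) \<le> (1 + E1) * inverse (real n ^ 2)) sequentially"
      using good by eventually_elim (use A_le in \<open>simp add: divide_inverse\<close>)
    show "summable (\<lambda>n. (1 + E1) * inverse (real n ^ 2))"
      by (intro summable_mult inverse_power_summable) simp
  qed
  then have ae: "AE \<omega> in M. eventually (\<lambda>n. \<omega> \<in> space M - A n) sequentially"
    using A_sets by (intro borel_cantelli_AE1) (auto simp: emeasure_eq_measure)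
  \<comment> \<open>The event \<open>A n\<close> does not depend on \<open>x\<close>, so outside it
    the supremum over the uncountable cube is bounded for each outcome separately.\<close>
  have key: "\<bar>S n x \<omega>\<bar> \<le> (lam1 + lam2) * rate n"
    if n: "good n" and \<omega>: "\<omega> \<in> space M - A n" and x: "x \<in> unit_cube" for n x \<omega>
  proof -
    have n0: "1 \<le> real n" "1 \<le> real n * h n" using n by (auto simp: good_def)
    obtain y where y: "y \<in> Q n" "window n (h n) y = window n (h n) x"
      "\<And>k. \<bar>x $ k - y $ k\<bar> \<le> 1 / real n ^ r" using netQ[OF n] x unfolding net_def by blast
    have Sy: "\<bar>S n y \<omega>\<bar> \<le> lam1 * rate n" using \<omega> y(1) n by (auto simp: A_def B_def)
    have sum: "(\<Sum>i\<in>Lam n. \<bar>eps i \<omega>\<bar>) \<le> real n ^ (d + 2)" using \<omega> n by (auto simp: A_def B'_def)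
    define D where "D = lam2 * (1 / real n ^ r / h n)"
    have "\<bar>S n x \<omega> - S n y \<omega>\<bar> \<le> (\<Sum>i\<in>Lam n. D * \<bar>eps i \<omega>\<bar>)"
    proof -
      have "S n x \<omega> - S n y \<omega> = (\<Sum>i\<in>Lam n. (kernel_weight K n (h n) x i - kernel_weight K n (h n) y i) * eps i \<omega>)"
        by (simp add: S_def left_diff_distrib sum_subtractf)
      also have "\<bar>\<dots>\<bar> \<le> (\<Sum>i\<in>Lam n. \<bar>(kernel_weight K n (h n) x i - kernel_weight K n (h n) y i) * eps i \<omega>\<bar>)"
        by (rule sum_abs)
      also have "\<dots> \<le> (\<Sum>i\<in>Lam n. D * \<bar>eps i \<omega>\<bar>)"
      proof (rule sum_mono)
        fix i :: "(int, 'd) vec" assume "i \<in> Lam n"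
        then have "\<bar>kernel_weight K n (h n) x i - kernel_weight K n (h n) y i\<bar> \<le> D"
          using kernel_weight_diff_le[OF hpos y(2,3)] by (simp add: D_def lam2_def mult.assoc)
        then show "\<bar>(kernel_weight K n (h n) x i - kernel_weight K n (h n) y i) * eps i \<omega>\<bar> \<le> D * \<bar>eps i \<omega>\<bar>"
          unfolding abs_mult by (rule mult_right_mono) simp
      qed
      finally show ?thesis .
    qed
    also have "\<dots> = D * (\<Sum>i\<in>Lam n. \<bar>eps i \<omega>\<bar>)" by (simp add: sum_distrib_left)
    also have "\<dots> \<le> D * real n ^ (d + 2)"
      using sum lam hpos[of n] by (intro mult_left_mono) (auto simp: D_def)
    also have "\<dots> = lam2 * (1 / (real n * h n) / real n ^ d)"
    proof -
      have "real n ^ r = real n ^ (d + 2) * (real n * real n ^ d)"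
        by (simp add: r_def mult_2 numeral_3_eq_3 flip: power_Suc power_add)
      then show ?thesis using n0 hpos[of n] by (simp add: D_def)
    qed
    also have "\<dots> \<le> lam2 * (1 / real n ^ d)"
      using n0 lam by (intro mult_left_mono divide_right_mono) (auto simp: divide_le_eq)
    also have "\<dots> \<le> lam2 * rate n" using rate_ge[OF n] lam by (intro mult_left_mono) auto
    finally show ?thesis using Sy by (simp add: distrib_right)
  qed
  show ?thesis
  proof (intro exI[of _ "lam1 + lam2"] conjI)
    show "0 < lam1 + lam2" using lam by simp
    show "AE \<omega> in M. limsup (\<lambda>n. (SUP x\<in>unit_cube. ereal \<bar>gn eps g K h n x \<omega> - integral\<^sup>L M (gn eps g K h n x)\<bar>)
        / ereal (ln (real n) powr (1 / q) / (real n * h n) powr (real CARD('d) / 2))) \<le> ereal (lam1 + lam2)"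
      using ae
    proof eventually_elim
      case (elim \<omega>)
      show ?case unfolding centered d_def[symmetric] rate_def[symmetric]
      proof (rule Limsup_bounded)
        show "eventually (\<lambda>n. (SUP x\<in>unit_cube. ereal \<bar>S n x \<omega>\<bar>) / ereal (rate n) \<le> ereal (lam1 + lam2)) sequentially"
          using elim good
        proof eventually_elim
          case (elim n)
          have "0 < 1 / real n ^ d" using elim by (simp add: good_def)
          then have "0 < rate n" using rate_ge[of n] elim by linarith
          moreover have "(SUP x\<in>unit_cube. ereal \<bar>S n x \<omega>\<bar>) \<le> ereal (rate n) * ereal (lam1 + lam2)"
            using key[of n \<omega>] elim by (intro SUP_least) (simp add: mult.commute)
          ultimately show ?case by (subst ereal_divide_le_pos) auto
        qed
      qed
    qed
  qed
qed

end
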